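(* Let $\omega$ satisfy the standing assumptions described in the context. Then $(T^\infty_{\omega,\mathrm v}(\mathbb R^{n+1}_+))^\ast$, the dual space of $T^\infty_{\omega,\mathrm v}(\mathbb R^{n+1}_+)$, coincides with $\widetilde T_\omega(\mathbb R^{n+1}_+)$ in the following sense. (i) For any $g\in\widetilde T_\omega(\mathbb R^{n+1}_+)$, define the linear functional $\ell$ by setting, for all $f\in T^\infty_{\omega,\mathrm v}(\mathbb R^{n+1}_+)$, $$\ell(f)=\int_{\mathbb R^{n+1}_+}f(x,t)g(x,t)\frac{dx\,dt}{t}.\qquad(\ast)$$ Then there exists a positive constant $C$, independent of $g$, such that $\|\ell\|_{(T^\infty_{\omega,\mathrm v})^\ast}\le C\|g\|_{\widetilde T_\omega}$. (ii) Conversely, for any $\ell\in(T^\infty_{\omega,\mathrm v}(\mathbb R^{n+1}_+))^\ast$, there exists $g\in\widetilde T_\omega(\mathbb R^{n+1}_+)$ such that $(\ast)$ holds for all $f\in T^\infty_{\omega,\mathrm v}(\mathbb R^{n+1}_+)$ and $\|g\|_{\widetilde T_\omega}\le C\|\ell\|_{(T^\infty_{\omega,\mathrm v})^\ast}$, where $C$ is independent of $\ell$.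
   Context: Decay index. $\theta(L)\in(0,\infty]$ is the decay index of a fixed linear operator $L$ in $L^2(\mathbb R^n)$ generating a holomorphic semigroup whose kernels satisfy $|p_t(x,y)|\le t^{-n/m}g(|x-y|/t^{1/m})$, with $m>0$ constant and $g$ positive, bounded, decreasing with $\lim_{r\to\infty}r^{n+\epsilon}g(r)=0$ for some $\epsilon>0$; namely $\theta(L)=\sup\{\epsilon>0:\lim_{r\to\infty}r^{n+\epsilon}g(r)=0\}$. ($L$ enters only through $\theta(L)$.) Orlicz function. A positive function $\omega$ on $(0,\infty)$ is of upper (resp. lower) type $p$ if there is $C>0$ with $\omega(st)\le Ct^p\omega(s)$ for all $s>0$ and all $t\ge1$ (resp. $0<t\le1$); $\widetilde p_0(\omega)$ is the supremum of all $p>0$ such that $\omega$ is of lower type $p$. Standing assumption: $\omega$ is positive, continuous, strictly increasing, subadditive, of upper type $1$, and $\widetilde p_0(\omega)\in(\frac n{n+\theta(L)},1]$. Put $\rho(t)=t^{-1}/\omega^{-1}(t^{-1})$ for $t\in(0,\infty)$. Tent spaces. $\mathbb R^{n+1}_+=\mathbb R^n\times(0,\infty)$, $\Gamma(x)=\{(y,t)\in\mathbb R^{n+1}_+:|x-y|<t\}$, and for open $O\subset\mathbb R^n$, $\widehat O=\mathbb R^{n+1}_+\setminus\bigcup_{x\in O^\complement}\Gamma(x)$. Balls are $B=B(x_B,r_B)\subset\mathbb R^n$. $T^\infty_\omega(\mathbb R^{n+1}_+)$ is the set of measurable $f$ on $\mathbb R^{n+1}_+$ with $\|f\|_{T^\infty_\omega}=\sup_{B}\frac1{\rho(|B|)}\big(\frac1{|B|}\int_{\widehat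 B}|f(y,t)|^2\frac{dy\,dt}t\big)^{1/2}<\infty$. $T^\infty_{\omega,1}$ is the subspace of those $f\in T^\infty_\omega$ with $\lim_{c\to0}\sup_{B:r_B\le c}\frac1{\rho(|B|)}\big(\frac1{|B|}\int_{\widehat B}|f|^2\frac{dy\,dt}t\big)^{1/2}=0$. $T^\infty_{\omega,c}$ is the set of $f\in T^\infty_\omega$ with compact support in $\mathbb R^{n+1}_+$, and $T^\infty_{\omega,\mathrm v}(\mathbb R^{n+1}_+)$ is the closure of $T^\infty_{\omega,c}$ in $T^\infty_{\omega,1}$, with the norm of $T^\infty_\omega$. A $T_\omega$-atom is a function $a$ on $\mathbb R^{n+1}_+$ for which there is a ball $B\subset\mathbb R^n$ with $\operatorname{supp}a\subset\widehat B$ and $\int_{\widehat B}|a(x,t)|^2\frac{dx\,dt}t\le|B|^{-1}[\rho(|B|)]^{-2}$; it is regarded as the functional $g\mapsto\int_{\mathbb R^{n+1}_+}a\,g\,\frac{dx\,dt}t$ on $T^\infty_\omega$. $\widetilde T_\omega(\mathbb R^{n+1}_+)$ is the set of all $f=\sum_j\lambda_ja_j$, the series converging in $(T^\infty_\omega(\mathbb R^{n+1}_+))^\ast$, with $\{a_j\}_j$ $T_\omega$-atoms and $\{\lambda_j\}_j\in\ell^1$ complex; $\|f\|_{\widetilde T_\omega}=\inf\sum_j|\lambda_j|$ over all such decompositions. For $f=\sum_j\lambda_ja_j\in\widetilde T_\omega$ and $g\in T^\infty_\omega$, $\int_{\mathbb R^{n+1}_+}f g\frac{dx\,dt}t$ denotes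 the pairing $\sum_j\lambda_j\int_{\mathbb R^{n+1}_+}a_jg\frac{dx\,dt}t$. *)

theory Defs
  imports "HOL-Analysis.Analysis"
begin

(* The Euclidean space R^n is a type 'a :: euclidean_space (n = DIM('a)) and balls are
   ball x r with r > 0. *)

section \<open>The decay index and the Orlicz function\<close>

(* The operator L itself enters only through the decay index, which is computed from the
   function g in the bound for the kernels of its semigroup. *)
definition decay_bound :: "nat \<Rightarrow> (real \<Rightarrow> real) \<Rightarrow> bool" where
  "decay_bound n g \<longleftrightarrow>
     (\<forall>r\<ge>0. g r > 0) \<and> bounded (g ` {0..}) \<and> antimono_on {0..} g \<and>
     (\<exists>\<epsilon>>0. ((\<lambda>r. r powr (real n + \<epsilon>) * g r) \<longlongrightarrow> 0) at_top)"

definition decay_index :: "nat \<Rightarrow> (real \<Rightarrow> real) \<Rightarrow> ereal" where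
  "decay_index n g =
     Sup {ereal \<epsilon> | \<epsilon>. \<epsilon> > 0 \<and> ((\<lambda>r. r powr (real n + \<epsilon>) * g r) \<longlongrightarrow> 0) at_top}"

definition upper_type :: "real \<Rightarrow> (real \<Rightarrow> real) \<Rightarrow> bool" where
  "upper_type p \<omega> \<longleftrightarrow> (\<exists>C>0. \<forall>s>0. \<forall>t\<ge>1. \<omega> (s * t) \<le> C * t powr p * \<omega> s)"

definition lower_type :: "real \<Rightarrow> (real \<Rightarrow> real) \<Rightarrow> bool" where
  "lower_type p \<omega> \<longleftrightarrow> (\<exists>C>0. \<forall>s>0. \<forall>t. 0 < t \<and> t \<le> 1 \<longrightarrow> \<omega> (s * t) \<le> C * t powr p * \<omega> s)"

definition lower_type_index :: "(real \<Rightarrow> real) \<Rightarrow> ereal" where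
  "lower_type_index \<omega> = Sup {ereal p | p. p > 0 \<and> lower_type p \<omega>}"

(* For \<theta> = \<infinity> the quotient n / (n + \<theta>) is 0 in ereal, as intended. *)
definition orlicz_standing :: "nat \<Rightarrow> ereal \<Rightarrow> (real \<Rightarrow> real) \<Rightarrow> bool" where
  "orlicz_standing n \<theta> \<omega> \<longleftrightarrow>
     (\<forall>t>0. \<omega> t > 0) \<and> continuous_on {0<..} \<omega> \<and> strict_mono_on {0<..} \<omega> \<and>
     (\<forall>s>0. \<forall>t>0. \<omega> (s + t) \<le> \<omega> s + \<omega> t) \<and> upper_type 1 \<omega> \<and>
     ereal (real n) / (ereal (real n) + \<theta>) < lower_type_index \<omega> \<and> lower_type_index \<omega> \<le> 1"

(* The standing assumptions make \<omega> a bijection of (0,\<infinity>) onto itself. *)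
definition orlicz_rho :: "(real \<Rightarrow> real) \<Rightarrow> real \<Rightarrow> real" where
  "orlicz_rho \<omega> t = inverse t / the_inv_into {0<..} \<omega> (inverse t)"

section \<open>Half space, cones and tents\<close>

definition half_space :: "('a::euclidean_space \<times> real) set" where
  "half_space = UNIV \<times> {0<..}"

definition cone_at :: "'a::euclidean_space \<Rightarrow> ('a \<times> real) set" where
  "cone_at x = {(y, t). (y, t) \<in> half_space \<and> dist x y < t}"

definition tent :: "'a::euclidean_space set \<Rightarrow> ('a \<times> real) set" where
  "tent O' = half_space - (\<Union>x\<in>- O'. cone_at x)"

(* The measure dy dt / t on the half space.  Functions on the half space are represented by
   functions on the whole of 'a \<times> real; their values outside the half space never matter. *)
definition tent_measure :: "('a::euclidean_space \<times> real) measure" where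
  "tent_measure = density (lebesgue_on half_space) (\<lambda>p. ennreal (1 / snd p))"

section \<open>Bounded linear functionals on a space of functions\<close>

(* V is a linear space of functions with seminorm N, functions not being identified when they
   agree almost everywhere.  A functional bounded with respect to N is automatically
   compatible with that identification.  The values of a functional outside V are irrelevant. *)
definition fun_dual :: "('b \<Rightarrow> complex) set \<Rightarrow> (('b \<Rightarrow> complex) \<Rightarrow> real) \<Rightarrow> (('b \<Rightarrow> complex) \<Rightarrow> complex) set" where
  "fun_dual V N = {l.
     (\<forall>f\<in>V. \<forall>h\<in>V. l (\<lambda>p. f p + h p) = l f + l h) \<and>
     (\<forall>c. \<forall>f\<in>V. l (\<lambda>p. c * f p) = c * l f) \<and>
     (\<exists>C. \<forall>f\<in>V. cmod (l f) \<le> C * N f)}"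

definition fun_dual_norm :: "('b \<Rightarrow> complex) set \<Rightarrow> (('b \<Rightarrow> complex) \<Rightarrow> real) \<Rightarrow> (('b \<Rightarrow> complex) \<Rightarrow> complex) \<Rightarrow> real" where
  "fun_dual_norm V N l = (SUP f\<in>{f \<in> V. N f \<le> 1}. cmod (l f))"

section \<open>Tent spaces\<close>

definition tent_avg :: "(real \<Rightarrow> real) \<Rightarrow> ('a::euclidean_space \<times> real \<Rightarrow> complex) \<Rightarrow> 'a \<Rightarrow> real \<Rightarrow> real" where
  "tent_avg \<omega> f x r =
     1 / orlicz_rho \<omega> (measure lebesgue (ball x r)) *
     sqrt (1 / measure lebesgue (ball x r) *
       (LINT p : tent (ball x r) | tent_measure. (cmod (f p))\<^sup>2))"

definition T_inf_norm :: "(real \<Rightarrow> real) \<Rightarrow> ('a::euclidean_space \<times> real \<Rightarrow> complex) \<Rightarrow> real" where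
  "T_inf_norm \<omega> f = (SUP (x, r)\<in>UNIV \<times> {0<..}. tent_avg \<omega> f x r)"

(* Finiteness of the norm, spelled out: all the integrals are finite and the supremum is. *)
definition T_inf :: "(real \<Rightarrow> real) \<Rightarrow> ('a::euclidean_space \<times> real \<Rightarrow> complex) set" where
  "T_inf \<omega> = {f \<in> borel_measurable tent_measure.
     (\<forall>x. \<forall>r>0. set_integrable tent_measure (tent (ball x r)) (\<lambda>p. (cmod (f p))\<^sup>2)) \<and>
     bdd_above ((\<lambda>(x, r). tent_avg \<omega> f x r) ` (UNIV \<times> {0<..}))}"

definition T_inf_1 :: "(real \<Rightarrow> real) \<Rightarrow> ('a::euclidean_space \<times> real \<Rightarrow> complex) set" where
  "T_inf_1 \<omega> = {f \<in> T_inf \<omega>.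
     ((\<lambda>c. SUP (x, r)\<in>UNIV \<times> {0<..c}. tent_avg \<omega> f x r) \<longlongrightarrow> 0) (at_right 0)}"

(* Supports are those of almost-everywhere classes. *)
definition T_inf_c :: "(real \<Rightarrow> real) \<Rightarrow> ('a::euclidean_space \<times> real \<Rightarrow> complex) set" where
  "T_inf_c \<omega> = {f \<in> T_inf \<omega>.
     \<exists>K. compact K \<and> K \<subseteq> half_space \<and> (AE p in tent_measure. p \<notin> K \<longrightarrow> f p = 0)}"

definition T_inf_v :: "(real \<Rightarrow> real) \<Rightarrow> ('a::euclidean_space \<times> real \<Rightarrow> complex) set" where
  "T_inf_v \<omega> = {f \<in> T_inf_1 \<omega>.
     \<forall>e>0. \<exists>h\<in>T_inf_c \<omega>. T_inf_norm \<omega> (\<lambda>p. f p - h p) < e}"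

section \<open>Atoms and the atomic space\<close>

definition T_atom :: "(real \<Rightarrow> real) \<Rightarrow> ('a::euclidean_space \<times> real \<Rightarrow> complex) \<Rightarrow> bool" where
  "T_atom \<omega> a \<longleftrightarrow> a \<in> borel_measurable tent_measure \<and>
     (\<exists>x. \<exists>r>0.
        (AE p in tent_measure. p \<notin> tent (ball x r) \<longrightarrow> a p = 0) \<and>
        set_integrable tent_measure (tent (ball x r)) (\<lambda>p. (cmod (a p))\<^sup>2) \<and>
        (LINT p : tent (ball x r) | tent_measure. (cmod (a p))\<^sup>2)
          \<le> inverse (measure lebesgue (ball x r)) *
             inverse ((orlicz_rho \<omega> (measure lebesgue (ball x r)))\<^sup>2))"

definition fun_pairing :: "('a::euclidean_space \<times> real \<Rightarrow> complex) \<Rightarrow> ('a \<times> real \<Rightarrow> complex) \<Rightarrow> complex" where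
  "fun_pairing a g = (LINT p | tent_measure. a p * g p)"

(* F = \<Sum>j. \<lambda> j a_j, with convergence in the norm of the dual of T_inf. *)
definition atomic_decomp ::
  "(real \<Rightarrow> real) \<Rightarrow> (('a::euclidean_space \<times> real \<Rightarrow> complex) \<Rightarrow> complex) \<Rightarrow>
   (nat \<Rightarrow> complex) \<Rightarrow> (nat \<Rightarrow> 'a \<times> real \<Rightarrow> complex) \<Rightarrow> bool" where
  "atomic_decomp \<omega> F lam a \<longleftrightarrow>
     (\<forall>j. T_atom \<omega> (a j)) \<and> summable (\<lambda>j. cmod (lam j)) \<and>
     (\<lambda>N. fun_dual_norm (T_inf \<omega>) (T_inf_norm \<omega>)
        (\<lambda>g. F g - (\<Sum>j<N. lam j * fun_pairing (a j) g))) \<longlonglongrightarrow> 0"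

definition T_tilde :: "(real \<Rightarrow> real) \<Rightarrow> (('a::euclidean_space \<times> real \<Rightarrow> complex) \<Rightarrow> complex) set" where
  "T_tilde \<omega> = {F \<in> fun_dual (T_inf \<omega>) (T_inf_norm \<omega>). \<exists>lam a. atomic_decomp \<omega> F lam a}"

definition T_tilde_norm :: "(real \<Rightarrow> real) \<Rightarrow> (('a::euclidean_space \<times> real \<Rightarrow> complex) \<Rightarrow> complex) \<Rightarrow> real" where
  "T_tilde_norm \<omega> F = Inf {\<Sum>j. cmod (lam j) | lam. \<exists>a. atomic_decomp \<omega> F lam a}"

(* The integral of F g dx dt / t for F in T_tilde and g in T_inf: the sum of the integrals of
   lam j * a_j * g, which is the same for all decompositions of F (it equals F g). *)
definition T_pairing :: "(real \<Rightarrow> real) \<Rightarrow> (('a::euclidean_space \<times> real \<Rightarrow> complex) \<Rightarrow> complex) \<Rightarrow>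
    ('a \<times> real \<Rightarrow> complex) \<Rightarrow> complex" where
  "T_pairing \<omega> F g =
     (THE z. \<exists>lam a. atomic_decomp \<omega> F lam a \<and> (\<lambda>j. lam j * fun_pairing (a j) g) sums z)"

end

theory Submission
  imports Defs "HOL-Library.Function_Algebras"
begin

text \<open>
  Put \<open>\<kappa>(r) = 1 / (\<rho>(v) sqrt v)\<close> where \<open>v\<close> is the volume of a ball of radius \<open>r\<close>. Then the norm of \<open>T_inf\<close> is the
  supremum, over all balls, of \<open>\<kappa>(r)\<close> times the norm of \<open>f\<close> in \<open>L\<^sup>2\<close> of the tent, and an atom is a
  function on a tent whose norm in \<open>L\<^sup>2\<close> is at most \<open>\<kappa>(r)\<close>. So the Cauchy-Schwarz inequality bounds the
  pairing of an atom with \<open>g\<close> by the norm of \<open>g\<close>. It follows that an atomic series converges at every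
  \<open>g\<close> in \<open>T_inf\<close>, that \<open>T_pairing\<close> is evaluation of the functional, and that the first half of the
  duality holds with constant 1.

  For the converse, \<open>T_inf_v\<close> is embedded into a space whose dual consists of atomic series from the
  outset. Take the countable net of balls centred at the points of \<open>2\<^sup>k \<int>\<^sup>n\<close> with radius \<open>(n + 1) 2\<^sup>k\<close>, where
  \<open>k\<close> runs through the integers. Every ball lies in a ball of the net of comparable radius, and \<open>\<kappa>\<close> is
  doubling, so the supremum over the net is equivalent to the norm of \<open>T_inf\<close>. For a function of
  \<open>T_inf_v\<close> the weighted norms tend to 0 along the net: if the support is compact then only finitely
  many balls of the net with a radius below a given bound have a tent that meets it, while \<open>\<kappa>(r)\<close> tends to 0
  as \<open>r\<close> grows; the general case follows by uniform approximation. Thus \<open>T_inf_v\<close> is isomorphic to a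
  subspace of a weighted \<open>c\<^sub>0\<close>-sum of the spaces \<open>L\<^sup>2\<close> of the tents of the net. By the Hahn-Banach theorem
  a functional \<open>l\<close> extends to that sum; the dual of a \<open>c\<^sub>0\<close>-sum is the \<open>\<ell>\<^sup>1\<close>-sum of the duals, and
  each \<open>L\<^sup>2\<close> is its own dual, so \<open>l f\<close> is the sum of \<open>\<integral> h\<^sub>j f\<close> with \<open>h\<^sub>j\<close> on the
  \<open>j\<close>-th tent and \<open>\<Sum>\<^sub>j \<parallel>h\<^sub>j\<parallel> / \<kappa>\<^sub>j\<close> bounded by a multiple of the norm of \<open>l\<close>
  (\<open>c0_L2_subspace_dual\<close>). After normalisation the \<open>h\<^sub>j\<close> are atoms and the numbers
  \<open>\<parallel>h\<^sub>j\<parallel> / \<kappa>\<^sub>j\<close> are their coefficients.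

  The function \<open>\<omega>\<close> enters only through \<open>\<kappa>\<close>. The lower bound for its type index provides a positive
  lower type, which makes \<open>\<omega>\<close> a bijection of the positive half line and \<open>\<kappa>\<close> doubling; the upper type 1
  makes \<open>\<kappa>\<close> vanish at infinity.
\<close>

section \<open>Real vector spaces of functions and the Hahn-Banach theorem\<close>

text \<open>
  Pointwise scalar multiplication makes functions, and sequences of functions, a real vector space, to
  which the Hahn-Banach theorem for the type class applies.
\<close>
instantiation "fun" :: (type, real_vector) real_vector
begin
definition scaleR_fun_def: "c *\<^sub>R f = (\<lambda>x. c *\<^sub>R f x)"
instance
  by standard (auto simp: scaleR_fun_def fun_eq_iff algebra_simps)
end

lemma scaleR_fun_apply [simp]: "(c *\<^sub>R f) x = c *\<^sub>R f x"
  by (simp add: scaleR_fun_def)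

text \<open>
  A linear functional dominated by a sublinear \<open>p\<close> is handled through its graph. The dominated subspaces
  of the product with the reals are automatically graphs: if \<open>(v, a)\<close> and \<open>(v, b)\<close> belong to one, so do
  \<open>(0, a - b)\<close> and its negative, and \<open>p 0 = 0\<close> forces \<open>a = b\<close>. Hence Zorn's lemma applies to plain sets
  ordered by inclusion. All hypotheses are relative to a subspace \<open>W\<close> because the norms to which the
  theorem is applied make sense only on part of the space of all functions.
\<close>
lemma hahn_banach_real:
  fixes W V :: "'v::real_vector set" and p l :: "'v \<Rightarrow> real"
  assumes W: "subspace W" and V: "subspace V" "V \<subseteq> W"
    and p_add: "\<And>v w. v \<in> W \<Longrightarrow> w \<in> W \<Longrightarrow> p (v + w) \<le> p v + p w"
    and p_scale: "\<And>c v. 0 < c \<Longrightarrow> v \<in> W \<Longrightarrow> p (c *\<^sub>R v) = c * p v"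
    and l_add: "\<And>v w. v \<in> V \<Longrightarrow> w \<in> V \<Longrightarrow> l (v + w) = l v + l w"
    and l_scale: "\<And>c v. v \<in> V \<Longrightarrow> l (c *\<^sub>R v) = c * l v"
    and l_le: "\<And>v. v \<in> V \<Longrightarrow> l v \<le> p v"
  obtains L where "\<And>v w. v \<in> W \<Longrightarrow> w \<in> W \<Longrightarrow> L (v + w) = L v + L w"
    and "\<And>c v. v \<in> W \<Longrightarrow> L (c *\<^sub>R v) = c * L v"
    and "\<And>v. v \<in> W \<Longrightarrow> L v \<le> p v"
    and "\<And>v. v \<in> V \<Longrightarrow> L v = l v"
proof -
  define G0 where "G0 = (\<lambda>v. (v, l v)) ` V"
  define \<G> where "\<G> = {G :: ('v \<times> real) set. G0 \<subseteq> G \<and> subspace G \<and> (\<forall>(v, a) \<in> G. v \<in> W \<and> a \<le> p v)}"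
  have "subspace G0"
    unfolding G0_def subspace_def using V(1) l_add l_scale l_scale[of 0 0]
    by (auto simp: subspace_0 subspace_add subspace_scale image_iff zero_prod_def
        intro!: bexI[of _ 0])
  then have "G0 \<in> \<G>"
    using V l_le by (auto simp: \<G>_def G0_def)
  moreover have "\<Union>C \<in> \<G>" if C: "C \<noteq> {}" "subset.chain \<G> C" for C
  proof -
    have mem: "G \<in> \<G>" if "G \<in> C" for G
      using C(2) that by (auto simp: subset.chain_def)
    have tot: "G \<subseteq> H \<or> H \<subseteq> G" if "G \<in> C" "H \<in> C" for G H
      using C(2) that by (auto simp: subset.chain_def)
    have "subspace (\<Union>C)"
      unfolding subspace_def
    proof (intro conjI ballI allI)
      show "0 \<in> \<Union>C"
        using C(1) mem by (auto simp: \<G>_def subspace_0)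
      show "x + y \<in> \<Union>C" if xy: "x \<in> \<Union>C" "y \<in> \<Union>C" for x y
      proof -
        obtain G H where "G \<in> C" "H \<in> C" "x \<in> G" "y \<in> H"
          using xy by auto
        then obtain K where "K \<in> C" "x \<in> K" "y \<in> K"
          using tot by blast
        then show ?thesis
          using mem[of K] subspace_add[of K x y] by (auto simp: \<G>_def)
      qed
      show "c *\<^sub>R x \<in> \<Union>C" if x: "x \<in> \<Union>C" for c x
      proof -
        obtain K where "K \<in> C" "x \<in> K"
          using x by auto
        then show ?thesis
          using mem[of K] subspace_scale[of K x c] by (auto simp: \<G>_def)
      qed
    qed
    then show ?thesis
      using C(1) mem by (auto simp: \<G>_def)
  qed
  ultimately obtain G where G: "G \<in> \<G>" and Gmax: "\<And>H. H \<in> \<G> \<Longrightarrow> G \<subseteq> H \<Longrightarrow> H = G"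
    using subset_Zorn_nonempty[of \<G>] by blast
  have Gs: "subspace G" and G0: "G0 \<subseteq> G" and GW: "\<And>v a. (v, a) \<in> G \<Longrightarrow> v \<in> W"
    and Gp: "\<And>v a. (v, a) \<in> G \<Longrightarrow> a \<le> p v"
    using G by (auto simp: \<G>_def)
  have p0: "p 0 = 0"
    using p_scale[of 2 0] W by (simp add: subspace_0)
  have uniq: "a = b" if "(v, a) \<in> G" "(v, b) \<in> G" for v a b
  proof -
    have "(0, a - b) \<in> G" "(0, b - a) \<in> G"
      using subspace_diff[OF Gs that] subspace_diff[OF Gs that(2,1)] by simp_all
    then show ?thesis
      using Gp[of 0 "a - b"] Gp[of 0 "b - a"] p0 by simp
  qed
  have dom: "\<exists>c. (w, c) \<in> G" if w: "w \<in> W" for w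
  proof -
    \<comment> \<open>A value \<open>c\<close> at \<open>w\<close> is admissible when it lies above all \<open>a - p (v - w)\<close> and below all
       \<open>p (v + w) - a\<close>; subadditivity separates these two sets of numbers.\<close>
    define S where "S = (\<lambda>(v, a). a - p (v - w)) ` G"
    have sep: "a - p (v - w) \<le> p (v' + w) - a'" if "(v, a) \<in> G" "(v', a') \<in> G" for v a v' a'
    proof -
      have "a + a' \<le> p (v + v')"
        using Gp subspace_add[OF Gs that] by simp
      also have "\<dots> = p ((v - w) + (v' + w))"
        by simp
      also have "\<dots> \<le> p (v - w) + p (v' + w)"
        by (intro p_add subspace_diff subspace_add W w GW[OF that(1)] GW[OF that(2)])
      finally show ?thesis
        by simp
    qed
    have zG: "(0, 0) \<in> G"
      using subspace_0[OF Gs] by (simp add: zero_prod_def)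
    have Sne: "S \<noteq> {}"
      using zG by (auto simp: S_def)
    have Sbdd: "bdd_above S"
      using sep[OF _ zG] by (auto simp: S_def intro!: bdd_aboveI)
    define c where "c = Sup S"
    have c1: "a - p (v - w) \<le> c" if "(v, a) \<in> G" for v a
      unfolding c_def using that Sbdd by (intro cSup_upper) (force simp: S_def)
    have c2: "c \<le> p (v + w) - a" if "(v, a) \<in> G" for v a
      unfolding c_def using Sne sep[OF _ that] by (intro cSup_least) (auto simp: S_def)
    define H where "H = (\<lambda>((v, a), t). (v + t *\<^sub>R w, a + t * c)) ` (G \<times> (UNIV :: real set))"
    have HI: "(v + t *\<^sub>R w, a + t * c) \<in> H" if "(v, a) \<in> G" for v a t
      unfolding H_def using that by force
    have HE: "\<exists>v a t. (v, a) \<in> G \<and> x = (v + t *\<^sub>R w, a + t * c)" if "x \<in> H" for x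
      using that unfolding H_def by auto
    have GH: "G \<subseteq> H"
      using HI[of _ _ 0] by auto
    have "subspace H"
      unfolding subspace_def
    proof (intro conjI ballI allI)
      show "0 \<in> H"
        using GH subspace_0[OF Gs] by auto
      show "x + y \<in> H" if "x \<in> H" "y \<in> H" for x y
      proof -
        obtain v a t v' a' t' where *: "(v, a) \<in> G" "(v', a') \<in> G"
          "x = (v + t *\<^sub>R w, a + t * c)" "y = (v' + t' *\<^sub>R w, a' + t' * c)"
          using HE[OF \<open>x \<in> H\<close>] HE[OF \<open>y \<in> H\<close>] by blast
        then show ?thesis
          using HI[of "v + v'" "a + a'" "t + t'"] subspace_add[OF Gs *(1,2)]
          by (simp add: algebra_simps)
      qed
      show "d *\<^sub>R x \<in> H" if "x \<in> H" for d x
      proof -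
        obtain v a t where *: "(v, a) \<in> G" "x = (v + t *\<^sub>R w, a + t * c)"
          using \<open>x \<in> H\<close> by (auto simp: H_def)
        then show ?thesis
          using HI[of "d *\<^sub>R v" "d * a" "d * t"] subspace_scale[OF Gs *(1), of d]
          by (simp add: algebra_simps)
      qed
    qed
    moreover have "v + t *\<^sub>R w \<in> W" if "(v, a) \<in> G" for v a t
      using GW[OF that] w W by (simp add: subspace_add subspace_scale)
    moreover have "a + t * c \<le> p (v + t *\<^sub>R w)" if va: "(v, a) \<in> G" for v a t
    proof (cases t "0::real" rule: linorder_cases)
      case equal
      then show ?thesis
        using Gp[OF va] by simp
    next
      case greater
      have sc: "((1 / t) *\<^sub>R v, a / t) \<in> G"
        using subspace_scale[OF Gs va, of "1 / t"] by simp
      have "t * c \<le> t * (p ((1 / t) *\<^sub>R v + w) - a / t)"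
        using c2[OF sc] greater by (intro mult_left_mono) auto
      also have "\<dots> = p (t *\<^sub>R ((1 / t) *\<^sub>R v + w)) - a"
        using greater p_scale[of t "(1 / t) *\<^sub>R v + w"] W GW[OF sc] w
        by (simp add: subspace_add right_diff_distrib)
      finally show ?thesis
        using greater by (simp add: algebra_simps)
    next
      case less
      define s where "s = - t"
      have s: "s > 0"
        using less by (simp add: s_def)
      have sc: "((1 / s) *\<^sub>R v, a / s) \<in> G"
        using subspace_scale[OF Gs va, of "1 / s"] by simp
      have "s * (a / s - p ((1 / s) *\<^sub>R v - w)) \<le> s * c"
        using c1[OF sc] s by (intro mult_left_mono) auto
      then have "a - p (s *\<^sub>R ((1 / s) *\<^sub>R v - w)) \<le> s * c"
        using s p_scale[of s "(1 / s) *\<^sub>R v - w"] W GW[OF sc] w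
        by (simp add: subspace_diff right_diff_distrib)
      then show ?thesis
        using s by (simp add: algebra_simps s_def)
    qed
    ultimately have "H \<in> \<G>"
      using GH G0 by (auto simp: \<G>_def H_def)
    then have "H = G"
      using Gmax GH by blast
    then show ?thesis
      using HI[OF zG, of 1] by auto
  qed
  define L where "L v = (THE a. (v, a) \<in> G)" for v
  have LG: "L v = a" if "(v, a) \<in> G" for v a
    unfolding L_def using that uniq by blast
  have GL: "(v, L v) \<in> G" if "v \<in> W" for v
    using dom[OF that] LG by auto
  show thesis
  proof (rule that)
    show "L (v + w) = L v + L w" if "v \<in> W" "w \<in> W" for v w
      using subspace_add[OF Gs GL[OF that(1)] GL[OF that(2)]] LG by simp
    show "L (c *\<^sub>R v) = c * L v" if "v \<in> W" for c v
      using subspace_scale[OF Gs GL[OF that], of c] LG by simp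
    show "L v \<le> p v" if "v \<in> W" for v
      using Gp[OF GL[OF that]] .
    show "L v = l v" if "v \<in> V" for v
      using G0 that by (intro LG) (auto simp: G0_def)
  qed
qed

section \<open>The space of square integrable functions and the Riesz representation theorem\<close>

text \<open>
  Elements are functions, not classes of functions that agree almost everywhere, to match the
  functions of the tent spaces; \<open>L2_norm\<close> is accordingly a seminorm.
\<close>
definition L2 :: "'x measure \<Rightarrow> ('x \<Rightarrow> complex) set" where
  "L2 M = {f \<in> borel_measurable M. integrable M (\<lambda>x. (cmod (f x))\<^sup>2)}"

definition L2_norm :: "'x measure \<Rightarrow> ('x \<Rightarrow> complex) \<Rightarrow> real" where
  "L2_norm M f = sqrt (LINT x|M. (cmod (f x))\<^sup>2)"

lemma L2_measurable: "f \<in> L2 M \<Longrightarrow> f \<in> borel_measurable M"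
  by (simp add: L2_def)

lemma L2_integrable: "f \<in> L2 M \<Longrightarrow> integrable M (\<lambda>x. (cmod (f x))\<^sup>2)"
  by (simp add: L2_def)

lemma L2_norm_nonneg [simp]: "0 \<le> L2_norm M f"
  by (simp add: L2_norm_def)

lemma L2_norm_square: "(L2_norm M f)\<^sup>2 = (LINT x|M. (cmod (f x))\<^sup>2)"
  by (simp add: L2_norm_def)

lemma cmod_mult_le: "cmod (a * b) \<le> (cmod a)\<^sup>2 + (cmod b)\<^sup>2"
proof -
  have "2 * cmod (a * b) \<le> (cmod a)\<^sup>2 + (cmod b)\<^sup>2"
    using sum_squares_bound[of "cmod a" "cmod b"] by (simp add: norm_mult)
  then show ?thesis
    using norm_ge_zero[of "a * b"] by linarith
qed

lemma L2_mult_integrable: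
  assumes "f \<in> L2 M" "g \<in> L2 M"
  shows "integrable M (\<lambda>x. f x * g x)"
proof (rule Bochner_Integration.integrable_bound)
  show "integrable M (\<lambda>x. (cmod (f x))\<^sup>2 + (cmod (g x))\<^sup>2)"
    using assms by (auto simp: L2_def)
  show "(\<lambda>x. f x * g x) \<in> borel_measurable M"
    using assms by (auto simp: L2_def)
  show "AE x in M. norm (f x * g x) \<le> norm ((cmod (f x))\<^sup>2 + (cmod (g x))\<^sup>2)"
    by (intro AE_I2) (simp add: cmod_mult_le)
qed

lemma L2_scale:
  assumes "f \<in> L2 M"
  shows "(\<lambda>x. c * f x) \<in> L2 M"
  using assms by (auto simp: L2_def norm_mult power_mult_distrib)

lemma L2_norm_scale: "L2_norm M (\<lambda>x. c * f x) = cmod c * L2_norm M f"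
  by (simp add: L2_norm_def norm_mult power_mult_distrib real_sqrt_mult)

lemma L2_add:
  assumes "f \<in> L2 M" "g \<in> L2 M"
  shows "(\<lambda>x. f x + g x) \<in> L2 M"
proof -
  have "integrable M (\<lambda>x. (cmod (f x + g x))\<^sup>2)"
  proof (rule Bochner_Integration.integrable_bound)
    show "integrable M (\<lambda>x. 2 * (cmod (f x))\<^sup>2 + 2 * (cmod (g x))\<^sup>2)"
      using assms by (auto simp: L2_def)
    show "(\<lambda>x. (cmod (f x + g x))\<^sup>2) \<in> borel_measurable M"
      using assms by (auto simp: L2_def)
    have "(cmod (f x + g x))\<^sup>2 \<le> 2 * (cmod (f x))\<^sup>2 + 2 * (cmod (g x))\<^sup>2" for x
    proof -
      have "(cmod (f x + g x))\<^sup>2 \<le> (cmod (f x) + cmod (g x))\<^sup>2"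
        by (intro power_mono norm_triangle_ineq) auto
      also have "\<dots> \<le> 2 * (cmod (f x))\<^sup>2 + 2 * (cmod (g x))\<^sup>2"
        using sum_squares_bound[of "cmod (f x)" "cmod (g x)"] by (simp add: power2_sum)
      finally show ?thesis .
    qed
    then show "AE x in M. norm ((cmod (f x + g x))\<^sup>2) \<le> norm (2 * (cmod (f x))\<^sup>2 + 2 * (cmod (g x))\<^sup>2)"
      by (intro AE_I2) (simp add: order_trans[OF _ abs_ge_self])
  qed
  then show ?thesis
    using assms by (auto simp: L2_def)
qed

lemma L2_cnj: "f \<in> L2 M \<Longrightarrow> (\<lambda>x. cnj (f x)) \<in> L2 M"
  by (auto simp: L2_def intro: measurable_compose[OF _ borel_measurable_continuous_onI] continuous_intros)

lemma L2_norm_cnj: "L2_norm M (\<lambda>x. cnj (f x)) = L2_norm M f"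
  by (simp add: L2_norm_def)

lemma subspace_L2: "subspace (L2 M)"
  unfolding subspace_def
proof (intro conjI ballI allI)
  show "0 \<in> L2 M"
    by (simp add: L2_def zero_fun_def)
  show "f + g \<in> L2 M" if "f \<in> L2 M" "g \<in> L2 M" for f g
    using L2_add[OF that] by (simp add: plus_fun_def)
  show "c *\<^sub>R f \<in> L2 M" if "f \<in> L2 M" for f c
    using L2_scale[OF that, of "of_real c"] by (simp add: scaleR_fun_def scaleR_conv_of_real)
qed

lemma L2_norm_scaleR: "L2_norm M (c *\<^sub>R f) = \<bar>c\<bar> * L2_norm M f"
  using L2_norm_scale[of M "of_real c" f] by (simp add: scaleR_fun_def scaleR_conv_of_real)

lemma L2_norm_zero [simp]: "L2_norm M 0 = 0"
  by (simp add: L2_norm_def zero_fun_def)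

lemma L2_norm_eq_0_AE:
  assumes "f \<in> L2 M" "L2_norm M f = 0"
  shows "AE x in M. f x = 0"
  using assms integral_nonneg_eq_0_iff_AE[OF L2_integrable[OF assms(1)]]
  by (simp add: L2_norm_def)

lemma L2_cauchy_schwarz:
  assumes f: "f \<in> L2 M" and g: "g \<in> L2 M"
  shows "cmod (LINT x|M. f x * g x) \<le> L2_norm M f * L2_norm M g"
proof (cases "L2_norm M f = 0 \<or> L2_norm M g = 0")
  case True
  then have "AE x in M. f x * g x = 0"
    using L2_norm_eq_0_AE[OF f] L2_norm_eq_0_AE[OF g] by auto
  then have "(LINT x|M. f x * g x) = 0"
    by (rule integral_eq_zero_AE)
  then show ?thesis
    by simp
next
  case False
  define a b where "a = L2_norm M f" and "b = L2_norm M g"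
  have ab: "a > 0" "b > 0"
    using False by (simp_all add: a_def b_def less_le)
  have "cmod (LINT x|M. f x * g x) \<le> (LINT x|M. cmod (f x * g x))"
    by (rule integral_norm_bound)
  also have "\<dots> \<le> (LINT x|M. (b / (2 * a)) * (cmod (f x))\<^sup>2 + (a / (2 * b)) * (cmod (g x))\<^sup>2)"
  proof (rule integral_mono)
    show "integrable M (\<lambda>x. cmod (f x * g x))"
      using L2_mult_integrable[OF f g] by simp
    show "integrable M (\<lambda>x. (b / (2 * a)) * (cmod (f x))\<^sup>2 + (a / (2 * b)) * (cmod (g x))\<^sup>2)"
      using L2_integrable[OF f] L2_integrable[OF g] by simp
    show "cmod (f x * g x) \<le> (b / (2 * a)) * (cmod (f x))\<^sup>2 + (a / (2 * b)) * (cmod (g x))\<^sup>2" for x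
    proof -
      have "2 * (b * cmod (f x)) * (a * cmod (g x)) \<le> (b * cmod (f x))\<^sup>2 + (a * cmod (g x))\<^sup>2"
        by (rule sum_squares_bound)
      then show ?thesis
        using ab by (simp add: norm_mult field_simps power2_eq_square)
    qed
  qed
  also have "\<dots> = (b / (2 * a)) * a\<^sup>2 + (a / (2 * b)) * b\<^sup>2"
    using L2_integrable[OF f] L2_integrable[OF g] by (simp add: a_def b_def L2_norm_square)
  also have "\<dots> = a * b"
    using ab by (simp add: power2_eq_square)
  finally show ?thesis
    by (simp add: a_def b_def)
qed

lemma L2_norm_add_square:
  assumes f: "f \<in> L2 M" and g: "g \<in> L2 M"
  shows "(L2_norm M (f + g))\<^sup>2 =
    (L2_norm M f)\<^sup>2 + (L2_norm M g)\<^sup>2 + 2 * Re (LINT x|M. cnj (f x) * g x)"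
proof -
  have int: "integrable M (\<lambda>x. cnj (f x) * g x)"
    by (rule L2_mult_integrable[OF L2_cnj[OF f] g])
  have "(cmod (f x + g x))\<^sup>2 = (cmod (f x))\<^sup>2 + (cmod (g x))\<^sup>2 + 2 * Re (cnj (f x) * g x)" for x
    by (simp only: cmod_power2) (simp add: power2_eq_square algebra_simps)
  then have "(L2_norm M (f + g))\<^sup>2 =
      (LINT x|M. (cmod (f x))\<^sup>2 + (cmod (g x))\<^sup>2 + 2 * Re (cnj (f x) * g x))"
    by (simp only: L2_norm_square plus_fun_apply)
  also have "\<dots> = (L2_norm M f)\<^sup>2 + (L2_norm M g)\<^sup>2 + 2 * (LINT x|M. Re (cnj (f x) * g x))"
    using L2_integrable[OF f] L2_integrable[OF g] integrable_Re[OF int]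
    by (simp add: L2_norm_square del: times_complex.sel)
  finally show ?thesis
    by (simp only: integral_Re[OF int])
qed

lemma L2_norm_triangle:
  assumes f: "f \<in> L2 M" and g: "g \<in> L2 M"
  shows "L2_norm M (f + g) \<le> L2_norm M f + L2_norm M g"
proof (rule power2_le_imp_le)
  have "Re (LINT x|M. cnj (f x) * g x) \<le> L2_norm M f * L2_norm M g"
    using L2_cauchy_schwarz[OF L2_cnj[OF f] g] complex_Re_le_cmod[of "LINT x|M. cnj (f x) * g x"]
    by (simp add: L2_norm_cnj)
  then show "(L2_norm M (f + g))\<^sup>2 \<le> (L2_norm M f + L2_norm M g)\<^sup>2"
    by (simp add: L2_norm_add_square[OF f g] power2_sum)
qed simp

text \<open>
  The identity that turns minimising sequences into Cauchy sequences in \<open>L2_riesz\<close>.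
\<close>
lemma L2_norm_parallelogram:
  assumes f: "f \<in> L2 M" and g: "g \<in> L2 M"
  shows "(L2_norm M (f + g))\<^sup>2 + (L2_norm M (f - g))\<^sup>2 = 2 * (L2_norm M f)\<^sup>2 + 2 * (L2_norm M g)\<^sup>2"
proof -
  have g': "(-1) *\<^sub>R g \<in> L2 M"
    using g subspace_L2 by (rule subspace_scale[rotated])
  have "f - g = f + (-1) *\<^sub>R g"
    by simp
  moreover have "(LINT x|M. cnj (f x) * ((-1) *\<^sub>R g) x) = - (LINT x|M. cnj (f x) * g x)"
    by simp
  ultimately show ?thesis
    using L2_norm_add_square[OF f g] L2_norm_add_square[OF f g'] L2_norm_scaleR[of M "-1" g]
    by simp
qed

text \<open>
  Completeness, for sequences that converge geometrically. The limit is the pointwise limit, and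
  Fatou's lemma carries the Cauchy estimate over to it.
\<close>
lemma L2_fast_cauchy_convergent:
  assumes f: "\<And>n. f n \<in> L2 M"
    and cauchy: "\<And>m n. n \<le> m \<Longrightarrow> (L2_norm M (f m - f n))\<^sup>2 \<le> (1/8) ^ n"
  obtains g where "g \<in> L2 M" "\<And>n. (L2_norm M (f n - g))\<^sup>2 \<le> (1/8) ^ n"
proof -
  have [measurable]: "f n \<in> borel_measurable M" for n
    using f by (rule L2_measurable)
  have diff: "f m - f n \<in> L2 M" for m n
    by (rule subspace_diff[OF subspace_L2 f f])
  have nn: "(\<integral>\<^sup>+x. ennreal ((cmod (f m x - f n x))\<^sup>2) \<partial>M) \<le> ennreal ((1/8) ^ n)" if "n \<le> m" for m n
    using cauchy[OF that] nn_integral_eq_integral[OF L2_integrable[OF diff[of m n]]]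
    by (simp add: L2_norm_square ennreal_leI)
  \<comment> \<open>The weights \<open>2 ^ n\<close> leave the sum of the squared increments integrable and, by
     \<open>d \<le> 2 ^ -n + 2 ^ n d\<^sup>2\<close>, make the increments themselves summable at almost every point.\<close>
  define D where "D n x = 2 ^ n * (cmod (f (Suc n) x - f n x))\<^sup>2" for n x
  have [measurable]: "D n \<in> borel_measurable M" for n
    unfolding D_def by measurable
  have D0: "0 \<le> D n x" for n x
    by (simp add: D_def)
  have "(\<integral>\<^sup>+x. (\<Sum>n. ennreal (D n x)) \<partial>M) = (\<Sum>n. \<integral>\<^sup>+x. ennreal (D n x) \<partial>M)"
    by (rule nn_integral_suminf) measurable
  also have "\<dots> \<le> (\<Sum>n. ennreal ((1/4) ^ n))"
  proof (intro suminf_le summableI)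
    fix n
    have "(\<integral>\<^sup>+x. ennreal (D n x) \<partial>M) = ennreal (2 ^ n) * (\<integral>\<^sup>+x. ennreal ((cmod (f (Suc n) x - f n x))\<^sup>2) \<partial>M)"
      unfolding D_def by (subst nn_integral_cmult[symmetric]) (auto simp: ennreal_mult)
    also have "\<dots> \<le> ennreal (2 ^ n) * ennreal ((1/8) ^ n)"
      by (intro mult_left_mono nn) auto
    also have "\<dots> = ennreal (2 ^ n * (1/8) ^ n)"
      by (rule ennreal_mult[symmetric]) auto
    also have "2 ^ n * (1/8) ^ n = (1/4 :: real) ^ n"
      by (simp flip: power_mult_distrib)
    finally show "(\<integral>\<^sup>+x. ennreal (D n x) \<partial>M) \<le> ennreal ((1/4) ^ n)" .
  qed
  also have "\<dots> < \<infinity>"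
    by (subst suminf_ennreal2) auto
  finally have "AE x in M. (\<Sum>n. ennreal (D n x)) \<noteq> \<infinity>"
    by (intro nn_integral_noteq_infinite) auto
  then have conv: "AE x in M. (\<lambda>n. f n x) \<longlonglongrightarrow> lim (\<lambda>n. f n x)"
  proof eventually_elim
    case (elim x)
    then have "summable (\<lambda>n. D n x)"
      using D0 by (intro summable_suminf_not_top) auto
    then have "summable (\<lambda>n. (1/2) ^ n + D n x)"
      by (intro summable_add) auto
    moreover have "norm (norm (f (Suc n) x - f n x)) \<le> (1/2) ^ n + D n x" for n
    proof -
      define s d where "s = (2::real) ^ n" and "d = cmod (f (Suc n) x - f n x)"
      have s: "s > 0"
        by (simp add: s_def)
      have "d \<le> (1 + (s * d)\<^sup>2) / s"
      proof -
        have "0 \<le> s * d"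
          using s by (simp add: d_def)
        then have "s * d \<le> 1 + (s * d)\<^sup>2"
          using sum_squares_bound[of "s * d" 1] by simp
        then show ?thesis
          using s by (simp add: field_simps)
      qed
      also have "\<dots> = 1 / s + s * d\<^sup>2"
        using s by (simp add: field_simps power2_eq_square)
      finally have "d \<le> 1 / s + s * d\<^sup>2" .
      then show ?thesis
        by (simp add: s_def d_def D_def power_one_over)
    qed
    ultimately have "summable (\<lambda>n. norm (f (Suc n) x - f n x))"
      by (rule summable_comparison_test')
    then have "summable (\<lambda>n. f (Suc n) x - f n x)"
      by (rule summable_norm_cancel)
    then have "(\<lambda>n. \<Sum>i<n. f (Suc i) x - f i x) \<longlonglongrightarrow> (\<Sum>n. f (Suc n) x - f n x)"
      by (simp add: summable_LIMSEQ)
    then have "(\<lambda>n. f n x - f 0 x) \<longlonglongrightarrow> (\<Sum>n. f (Suc n) x - f n x)"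
      by (simp only: sum_lessThan_telescope[of "\<lambda>i. f i x"])
    then have "(\<lambda>n. f n x - f 0 x + f 0 x) \<longlonglongrightarrow> (\<Sum>n. f (Suc n) x - f n x) + f 0 x"
      by (intro tendsto_add tendsto_const)
    then have "convergent (\<lambda>n. f n x)"
      by (auto simp: convergent_def)
    then show ?case
      by (simp add: convergent_LIMSEQ_iff)
  qed
  define g where "g x = lim (\<lambda>n. f n x)" for x
  have [measurable]: "g \<in> borel_measurable M"
    unfolding g_def by measurable
  have le: "(\<integral>\<^sup>+x. ennreal ((cmod (f n x - g x))\<^sup>2) \<partial>M) \<le> ennreal ((1/8) ^ n)" for n
  proof -
    have "(\<integral>\<^sup>+x. ennreal ((cmod (f n x - g x))\<^sup>2) \<partial>M)
        = (\<integral>\<^sup>+x. liminf (\<lambda>m. ennreal ((cmod (f m x - f n x))\<^sup>2)) \<partial>M)"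
    proof (rule nn_integral_cong_AE)
      show "AE x in M. ennreal ((cmod (f n x - g x))\<^sup>2) = liminf (\<lambda>m. ennreal ((cmod (f m x - f n x))\<^sup>2))"
        using conv
      proof eventually_elim
        case (elim x)
        then have "(\<lambda>m. ennreal ((cmod (f m x - f n x))\<^sup>2)) \<longlonglongrightarrow> ennreal ((cmod (g x - f n x))\<^sup>2)"
          unfolding g_def by (intro tendsto_intros)
        then show ?case
          by (simp only: lim_imp_Liminf[OF sequentially_bot] norm_minus_commute)
      qed
    qed
    also have "\<dots> \<le> liminf (\<lambda>m. \<integral>\<^sup>+x. ennreal ((cmod (f m x - f n x))\<^sup>2) \<partial>M)"
      by (rule nn_integral_liminf) measurable
    also have "\<dots> \<le> liminf (\<lambda>m::nat. ennreal ((1/8) ^ n))"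
      using nn by (intro Liminf_mono eventually_sequentiallyI[of n]) auto
    also have "\<dots> = ennreal ((1/8) ^ n)"
      by (simp add: Liminf_const)
    finally show ?thesis .
  qed
  have fg: "f n - g \<in> L2 M" for n
  proof -
    have "integrable M (\<lambda>x. (cmod (f n x - g x))\<^sup>2)"
      using le[of n] by (intro integrableI_bounded) (auto simp: le_less_trans[OF _ ennreal_less_top])
    then show ?thesis
      by (simp add: L2_def fun_diff_def)
  qed
  show thesis
  proof
    show "g \<in> L2 M"
      using subspace_diff[OF subspace_L2 f[of 0] fg[of 0]] by simp
    show "(L2_norm M (f n - g))\<^sup>2 \<le> (1/8) ^ n" for n
      using le[of n] nn_integral_eq_integral[OF L2_integrable[OF fg[of n]]]
      by (simp add: L2_norm_square)
  qed
qed

lemma linear_coefficient_eq_0: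
  fixes a b :: real
  assumes "0 \<le> a" "\<And>t. 0 \<le> t\<^sup>2 * a + 2 * t * b"
  shows "b = 0"
proof (rule ccontr)
  assume "b \<noteq> 0"
  define c where "c = b / (a + 1)"
  have c: "b = c * (a + 1)" "c \<noteq> 0"
    using assms(1) \<open>b \<noteq> 0\<close> by (auto simp: c_def)
  have "(- c)\<^sup>2 * a + 2 * (- c) * b = - (c\<^sup>2 * (a + 2))"
    by (simp add: c(1) power2_eq_square algebra_simps)
  moreover have "c\<^sup>2 * (a + 2) > 0"
    using assms(1) c(2) by simp
  ultimately show False
    using assms(2)[of "- c"] by simp
qed

text \<open>
  The representing function is found by minimising \<open>J f = \<parallel>f\<parallel>\<^sup>2 - 2 u f\<close>, which is bounded below by
  \<open>- C\<^sup>2\<close>. By the parallelogram law a minimising sequence is Cauchy, and at the minimum \<open>g\<close> the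
  derivative of \<open>J\<close> vanishes in every direction \<open>k\<close>, which says that \<open>u k\<close> is the real part of the
  integral of \<open>cnj g k\<close>. The functional is only real linear: that is what the real Hahn-Banach theorem
  supplies, and complex linearity is restored in \<open>c0_L2_subspace_dual\<close>.
\<close>
lemma L2_riesz:
  fixes u :: "('x \<Rightarrow> complex) \<Rightarrow> real"
  assumes add: "\<And>f g. f \<in> L2 M \<Longrightarrow> g \<in> L2 M \<Longrightarrow> u (f + g) = u f + u g"
    and scale: "\<And>c f. f \<in> L2 M \<Longrightarrow> u (c *\<^sub>R f) = c * u f"
    and bound: "\<And>f. f \<in> L2 M \<Longrightarrow> u f \<le> C * L2_norm M f"
  obtains h where "h \<in> L2 M" "\<And>f. f \<in> L2 M \<Longrightarrow> u f = Re (LINT x|M. h x * f x)"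
proof -
  note S = subspace_L2[of M]
  define J where "J f = (L2_norm M f)\<^sup>2 - 2 * u f" for f
  have J_ge: "- C\<^sup>2 \<le> J f" if "f \<in> L2 M" for f
    using bound[OF that] zero_le_power2[of "L2_norm M f - C"] by (simp add: J_def power2_diff algebra_simps)
  define m where "m = Inf (J ` L2 M)"
  have bdd: "bdd_below (J ` L2 M)"
    using J_ge by (intro bdd_belowI2)
  have J_m: "m \<le> J f" if "f \<in> L2 M" for f
    unfolding m_def using bdd that by (intro cInf_lower) auto
  have "\<exists>f\<in>L2 M. J f < m + (1/8) ^ n / 4" for n
    using cInf_lessD[of "J ` L2 M" "m + (1/8) ^ n / 4"] subspace_0[OF S] by (auto simp: m_def)
  then obtain f where f: "f n \<in> L2 M" and Jf: "J (f n) < m + (1/8) ^ n / 4" for n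
    by metis
  have u_diff: "u (f - g) = u f - u g" if "f \<in> L2 M" "g \<in> L2 M" for f g
    using add[OF that(1) subspace_scale[OF S that(2), of "-1"]] scale[OF that(2), of "-1"] by simp
  have "(L2_norm M (f k - f n))\<^sup>2 \<le> (1/8) ^ n" if "n \<le> k" for k n
  proof -
    have "m \<le> J ((1/2) *\<^sub>R (f k + f n))"
      using f S by (intro J_m) (simp add: subspace_add subspace_scale)
    also have "\<dots> = (L2_norm M (f k + f n))\<^sup>2 / 4 - (u (f k) + u (f n))"
    proof -
      have "u ((1/2) *\<^sub>R (f k + f n)) = (u (f k) + u (f n)) / 2"
        using f S by (simp add: scale subspace_add add)
      moreover have "(L2_norm M ((1/2) *\<^sub>R (f k + f n)))\<^sup>2 = (L2_norm M (f k + f n))\<^sup>2 / 4"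
        by (simp only: L2_norm_scaleR power_mult_distrib) (simp add: power_divide)
      ultimately show ?thesis
        by (simp only: J_def) (simp add: field_simps)
    qed
    finally have "(L2_norm M (f k - f n))\<^sup>2 \<le> 2 * (J (f k) - m) + 2 * (J (f n) - m)"
      using L2_norm_parallelogram[OF f f, of k n] by (simp add: J_def)
    also have "\<dots> \<le> 2 * ((1/8) ^ n / 4) + 2 * ((1/8) ^ n / 4)"
    proof -
      define s t where "s = (1/8::real) ^ k" and "t = (1/8::real) ^ n"
      have "s \<le> t"
        unfolding s_def t_def using that by (intro power_decreasing) auto
      then show ?thesis
        using Jf[of k] Jf[of n] by (simp add: s_def[symmetric] t_def[symmetric])
    qed
    finally show ?thesis
      by simp
  qed
  then obtain g where g: "g \<in> L2 M" and fg: "\<And>n. (L2_norm M (f n - g))\<^sup>2 \<le> (1/8) ^ n"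
    using L2_fast_cauchy_convergent[of f M] f by blast
  have lim0: "(\<lambda>n. L2_norm M (f n - g)) \<longlonglongrightarrow> 0"
  proof -
    have "(\<lambda>n. (L2_norm M (f n - g))\<^sup>2) \<longlonglongrightarrow> 0"
    proof (rule tendsto_sandwich[OF _ _ tendsto_const])
      show "(\<lambda>n. (1/8::real) ^ n) \<longlonglongrightarrow> 0"
        by (intro LIMSEQ_realpow_zero) auto
    qed (use fg in auto)
    then show ?thesis
      using tendsto_real_sqrt[of "\<lambda>n. (L2_norm M (f n - g))\<^sup>2" 0 sequentially] by simp
  qed
  have "(\<lambda>n. L2_norm M (f n)) \<longlonglongrightarrow> L2_norm M g"
  proof (rule Lim_transform_bound[OF _ lim0, THEN LIM_zero_cancel])
    show "\<forall>\<^sub>F n in sequentially. norm (L2_norm M (f n) - L2_norm M g) \<le> norm (L2_norm M (f n - g))"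
    proof (intro always_eventually allI)
      fix n
      have d: "f n - g \<in> L2 M" "g - f n \<in> L2 M"
        using f g S by (simp_all add: subspace_diff)
      have "L2_norm M (g - f n) = L2_norm M (f n - g)"
        using L2_norm_scaleR[of M "-1" "f n - g"] by simp
      then show "norm (L2_norm M (f n) - L2_norm M g) \<le> norm (L2_norm M (f n - g))"
        using L2_norm_triangle[OF d(1) g] L2_norm_triangle[OF d(2) f[of n]] by simp
    qed
  qed
  moreover have "(\<lambda>n. u (f n)) \<longlonglongrightarrow> u g"
  proof (rule LIM_zero_cancel, rule Lim_null_comparison[where g = "\<lambda>n. C * L2_norm M (f n - g)"])
    show "\<forall>\<^sub>F n in sequentially. norm (u (f n) - u g) \<le> C * L2_norm M (f n - g)"
    proof (intro always_eventually allI)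
      fix n
      have d: "f n - g \<in> L2 M" "g - f n \<in> L2 M"
        using f g S by (simp_all add: subspace_diff)
      have "L2_norm M (g - f n) = L2_norm M (f n - g)"
        using L2_norm_scaleR[of M "-1" "f n - g"] by simp
      then show "norm (u (f n) - u g) \<le> C * L2_norm M (f n - g)"
        using bound[OF d(1)] bound[OF d(2)] u_diff f g by simp
    qed
    show "(\<lambda>n. C * L2_norm M (f n - g)) \<longlonglongrightarrow> 0"
      using tendsto_mult_left[OF lim0, of C] by simp
  qed
  ultimately have "(\<lambda>n. J (f n)) \<longlonglongrightarrow> J g"
    unfolding J_def by (intro tendsto_intros)
  moreover have "(\<lambda>n. m + (1/8) ^ n / 4) \<longlonglongrightarrow> m + 0 / 4"
    by (intro tendsto_intros LIMSEQ_realpow_zero) auto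
  ultimately have Jg: "J g \<le> m"
    using Jf by (intro LIMSEQ_le[of "\<lambda>n. J (f n)" _ "\<lambda>n. m + (1/8) ^ n / 4"]) (auto intro: less_imp_le)
  show thesis
  proof
    show "(\<lambda>x. cnj (g x)) \<in> L2 M"
      using g by (rule L2_cnj)
    show "u k = Re (LINT x|M. cnj (g x) * k x)" if k: "k \<in> L2 M" for k
    proof -
      define b where "b = Re (LINT x|M. cnj (g x) * k x) - u k"
      have "0 \<le> t\<^sup>2 * (L2_norm M k)\<^sup>2 + 2 * t * b" for t
      proof -
        have tk: "t *\<^sub>R k \<in> L2 M"
          using S k by (rule subspace_scale)
        have "0 \<le> J (g + t *\<^sub>R k) - J g"
          using J_m[of "g + t *\<^sub>R k"] Jg g tk S by (simp add: subspace_add)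
        also have "\<dots> = t\<^sup>2 * (L2_norm M k)\<^sup>2 + 2 * t * b"
          using L2_norm_add_square[OF g tk]
          by (simp add: J_def add[OF g tk] scale[OF k] L2_norm_scaleR power_mult_distrib b_def algebra_simps)
        finally show ?thesis .
      qed
      then have "b = 0"
        by (intro linear_coefficient_eq_0[of "(L2_norm M k)\<^sup>2"]) auto
      then show ?thesis
        by (simp add: b_def)
    qed
  qed
qed

section \<open>Functionals on weighted null sequences of square integrable functions\<close>

text \<open>
  The weighted \<open>c\<^sub>0\<close>-sum of the spaces \<open>L2 (\<mu> j)\<close>.
\<close>
definition c0_L2 :: "(nat \<Rightarrow> 'x measure) \<Rightarrow> (nat \<Rightarrow> real) \<Rightarrow> (nat \<Rightarrow> 'x \<Rightarrow> complex) set" where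
  "c0_L2 \<mu> \<kappa> = {F. (\<forall>j. F j \<in> L2 (\<mu> j)) \<and> (\<lambda>j. \<kappa> j * L2_norm (\<mu> j) (F j)) \<longlonglongrightarrow> 0}"

definition c0_L2_norm :: "(nat \<Rightarrow> 'x measure) \<Rightarrow> (nat \<Rightarrow> real) \<Rightarrow> (nat \<Rightarrow> 'x \<Rightarrow> complex) \<Rightarrow> real" where
  "c0_L2_norm \<mu> \<kappa> F = (SUP j. \<kappa> j * L2_norm (\<mu> j) (F j))"

context
  fixes \<mu> :: "nat \<Rightarrow> 'x measure" and \<kappa> :: "nat \<Rightarrow> real"
  assumes \<kappa>: "\<And>j. 0 < \<kappa> j"
begin

lemma c0_L2_norm_upper:
  assumes "F \<in> c0_L2 \<mu> \<kappa>"
  shows "\<kappa> j * L2_norm (\<mu> j) (F j) \<le> c0_L2_norm \<mu> \<kappa> F"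
proof -
  have "convergent (\<lambda>j. \<kappa> j * L2_norm (\<mu> j) (F j))"
    using assms by (auto simp: c0_L2_def convergent_def)
  then have "Bseq (\<lambda>j. \<kappa> j * L2_norm (\<mu> j) (F j))"
    by (rule convergent_imp_Bseq)
  then show ?thesis
    unfolding c0_L2_norm_def by (intro cSUP_upper bounded_imp_bdd_above) (auto simp: Bseq_eq_bounded)
qed

lemma c0_L2_norm_least:
  assumes "\<And>j. \<kappa> j * L2_norm (\<mu> j) (F j) \<le> B"
  shows "c0_L2_norm \<mu> \<kappa> F \<le> B"
  unfolding c0_L2_norm_def using assms by (intro cSUP_least) auto

lemma subspace_c0_L2: "subspace (c0_L2 \<mu> \<kappa>)"
  unfolding subspace_def
proof (intro conjI ballI allI)
  show "0 \<in> c0_L2 \<mu> \<kappa>"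
    by (simp add: c0_L2_def subspace_0[OF subspace_L2])
  show "F + G \<in> c0_L2 \<mu> \<kappa>" if F: "F \<in> c0_L2 \<mu> \<kappa>" and G: "G \<in> c0_L2 \<mu> \<kappa>" for F G
  proof -
    have L: "F j \<in> L2 (\<mu> j)" "G j \<in> L2 (\<mu> j)" for j
      using F G by (auto simp: c0_L2_def)
    have "(\<lambda>j. \<kappa> j * L2_norm (\<mu> j) ((F + G) j)) \<longlonglongrightarrow> 0"
    proof (rule tendsto_sandwich[OF _ _ tendsto_const])
      show "(\<lambda>j. \<kappa> j * L2_norm (\<mu> j) (F j) + \<kappa> j * L2_norm (\<mu> j) (G j)) \<longlonglongrightarrow> 0"
        using F G by (auto simp: c0_L2_def intro: tendsto_add_zero)
      show "\<forall>\<^sub>F j in sequentially. \<kappa> j * L2_norm (\<mu> j) ((F + G) j)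
          \<le> \<kappa> j * L2_norm (\<mu> j) (F j) + \<kappa> j * L2_norm (\<mu> j) (G j)"
        using L2_norm_triangle[OF L] \<kappa>
        by (auto intro!: always_eventually mult_left_mono simp: less_imp_le simp flip: distrib_left)
    qed (use \<kappa> in \<open>auto simp: less_imp_le intro!: always_eventually\<close>)
    then show ?thesis
      using L by (simp add: c0_L2_def subspace_add[OF subspace_L2])
  qed
  show "c *\<^sub>R F \<in> c0_L2 \<mu> \<kappa>" if F: "F \<in> c0_L2 \<mu> \<kappa>" for c F
  proof -
    have "(\<lambda>j. \<bar>c\<bar> * (\<kappa> j * L2_norm (\<mu> j) (F j))) \<longlonglongrightarrow> 0"
      using F by (intro tendsto_mult_right_zero) (simp add: c0_L2_def)
    then show ?thesis
      using F by (simp add: c0_L2_def subspace_scale[OF subspace_L2] L2_norm_scaleR mult.left_commute)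
  qed
qed

lemma c0_L2_norm_triangle:
  assumes "F \<in> c0_L2 \<mu> \<kappa>" "G \<in> c0_L2 \<mu> \<kappa>"
  shows "c0_L2_norm \<mu> \<kappa> (F + G) \<le> c0_L2_norm \<mu> \<kappa> F + c0_L2_norm \<mu> \<kappa> G"
proof (rule c0_L2_norm_least)
  fix j
  have "\<kappa> j * L2_norm (\<mu> j) ((F + G) j) \<le> \<kappa> j * (L2_norm (\<mu> j) (F j) + L2_norm (\<mu> j) (G j))"
    using assms \<kappa>[of j] by (auto simp: c0_L2_def intro!: mult_left_mono L2_norm_triangle)
  also have "\<dots> \<le> c0_L2_norm \<mu> \<kappa> F + c0_L2_norm \<mu> \<kappa> G"
    using c0_L2_norm_upper[OF assms(1), of j] c0_L2_norm_upper[OF assms(2), of j]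
    by (simp add: distrib_left)
  finally show "\<kappa> j * L2_norm (\<mu> j) ((F + G) j) \<le> c0_L2_norm \<mu> \<kappa> F + c0_L2_norm \<mu> \<kappa> G" .
qed

lemma c0_L2_norm_scaleR:
  assumes "F \<in> c0_L2 \<mu> \<kappa>" "0 < c"
  shows "c0_L2_norm \<mu> \<kappa> (c *\<^sub>R F) = c * c0_L2_norm \<mu> \<kappa> F"
proof -
  have le: "c0_L2_norm \<mu> \<kappa> (c *\<^sub>R F) \<le> c * c0_L2_norm \<mu> \<kappa> F" if "F \<in> c0_L2 \<mu> \<kappa>" "0 < c" for c F
  proof (rule c0_L2_norm_least)
    show "\<kappa> j * L2_norm (\<mu> j) ((c *\<^sub>R F) j) \<le> c * c0_L2_norm \<mu> \<kappa> F" for j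
      using mult_left_mono[OF c0_L2_norm_upper[OF that(1), of j], of c] that(2)
      by (simp add: L2_norm_scaleR mult.left_commute)
  qed
  have "c0_L2_norm \<mu> \<kappa> F \<le> 1 / c * c0_L2_norm \<mu> \<kappa> (c *\<^sub>R F)"
    using le[of "c *\<^sub>R F" "1 / c"] assms subspace_scale[OF subspace_c0_L2, of F c] by simp
  then show ?thesis
    using le[OF assms] assms(2) by (simp add: field_simps)
qed

lemma c0_L2_finite_support:
  assumes "\<And>j. F j \<in> L2 (\<mu> j)" "\<And>j. N \<le> j \<Longrightarrow> F j = 0"
  shows "F \<in> c0_L2 \<mu> \<kappa>"
proof -
  have "(\<lambda>j. \<kappa> j * L2_norm (\<mu> j) (F j)) \<longlonglongrightarrow> 0"
    by (rule tendsto_eventually, rule eventually_sequentiallyI[of N]) (simp add: assms(2))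
  then show ?thesis
    using assms(1) by (simp add: c0_L2_def)
qed

text \<open>
  Restricted to the \<open>j\<close>-th coordinate, \<open>L\<close> is represented by some \<open>h\<^sub>j\<close>. Since truncations converge
  to \<open>F\<close> in a \<open>c\<^sub>0\<close>-sum, \<open>L F\<close> is the sum of its coordinate parts. Testing \<open>L\<close> against the finite sequence
  whose entries are the \<open>cnj h\<^sub>j\<close>, scaled to weighted norm 1, gives the summability of the norms.
\<close>
lemma c0_L2_functional:
  fixes L :: "(nat \<Rightarrow> 'x \<Rightarrow> complex) \<Rightarrow> real"
  assumes C: "0 \<le> C"
    and add: "\<And>F G. F \<in> c0_L2 \<mu> \<kappa> \<Longrightarrow> G \<in> c0_L2 \<mu> \<kappa> \<Longrightarrow> L (F + G) = L F + L G"
    and scale: "\<And>c F. F \<in> c0_L2 \<mu> \<kappa> \<Longrightarrow> L (c *\<^sub>R F) = c * L F"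
    and le: "\<And>F. F \<in> c0_L2 \<mu> \<kappa> \<Longrightarrow> L F \<le> C * c0_L2_norm \<mu> \<kappa> F"
  obtains h where "\<And>j. h j \<in> L2 (\<mu> j)"
    and "\<And>N. (\<Sum>j<N. L2_norm (\<mu> j) (h j) / \<kappa> j) \<le> C"
    and "\<And>F. F \<in> c0_L2 \<mu> \<kappa> \<Longrightarrow> (\<lambda>j. Re (LINT x|\<mu> j. h j x * F j x)) sums L F"
proof -
  note S = subspace_c0_L2
  define \<iota> :: "nat \<Rightarrow> ('x \<Rightarrow> complex) \<Rightarrow> nat \<Rightarrow> 'x \<Rightarrow> complex"
    where "\<iota> j f = (\<lambda>i. if i = j then f else 0)" for j f
  have \<iota>: "\<iota> j f \<in> c0_L2 \<mu> \<kappa>" if "f \<in> L2 (\<mu> j)" for j f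
    using that by (intro c0_L2_finite_support[of _ "Suc j"]) (auto simp: \<iota>_def subspace_0[OF subspace_L2])
  have "\<exists>h. h \<in> L2 (\<mu> j) \<and> (\<forall>f\<in>L2 (\<mu> j). L (\<iota> j f) = Re (LINT x|\<mu> j. h x * f x))" for j
  proof -
    have "L (\<iota> j (f + g)) = L (\<iota> j f) + L (\<iota> j g)" if "f \<in> L2 (\<mu> j)" "g \<in> L2 (\<mu> j)" for f g
    proof -
      have "\<iota> j (f + g) = \<iota> j f + \<iota> j g"
        by (auto simp: \<iota>_def fun_eq_iff)
      then show ?thesis
        using add[OF \<iota> \<iota>] that by simp
    qed
    moreover have "L (\<iota> j (c *\<^sub>R f)) = c * L (\<iota> j f)" if "f \<in> L2 (\<mu> j)" for c f
    proof -
      have "\<iota> j (c *\<^sub>R f) = c *\<^sub>R \<iota> j f"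
        by (auto simp: \<iota>_def fun_eq_iff)
      then show ?thesis
        using scale[OF \<iota>] that by simp
    qed
    moreover have "L (\<iota> j f) \<le> (C * \<kappa> j) * L2_norm (\<mu> j) f" if "f \<in> L2 (\<mu> j)" for f
    proof -
      have "c0_L2_norm \<mu> \<kappa> (\<iota> j f) \<le> \<kappa> j * L2_norm (\<mu> j) f"
        using \<kappa>[of j] by (intro c0_L2_norm_least) (auto simp: \<iota>_def)
      then show ?thesis
        using le[OF \<iota>[OF that]] mult_left_mono[OF _ C] by (fastforce simp: mult.assoc)
    qed
    ultimately show ?thesis
      by (rule L2_riesz[of "\<mu> j" "\<lambda>f. L (\<iota> j f)"]) auto
  qed
  then obtain h where h: "h j \<in> L2 (\<mu> j)"
    and hL: "\<And>f. f \<in> L2 (\<mu> j) \<Longrightarrow> L (\<iota> j f) = Re (LINT x|\<mu> j. h j x * f x)" for j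
    by metis
  define T where "T N F = (\<lambda>i. if i < N then F i else (0 :: 'x \<Rightarrow> complex))" for N :: nat and F
  have T: "T N F \<in> c0_L2 \<mu> \<kappa>" if "\<And>j. F j \<in> L2 (\<mu> j)" for N F
    using that by (intro c0_L2_finite_support[of _ N]) (auto simp: T_def subspace_0[OF subspace_L2])
  have LT: "L (T N F) = (\<Sum>j<N. Re (LINT x|\<mu> j. h j x * F j x))" if F: "\<And>j. F j \<in> L2 (\<mu> j)" for N F
  proof (induction N)
    case 0
    have "T 0 F = 0"
      by (simp add: T_def fun_eq_iff)
    then have "L (T 0 F) = L 0"
      by (rule arg_cong)
    then show ?case
      using scale[OF subspace_0[OF S], of 0] by simp
  next
    case (Suc N)
    have *: "T (Suc N) F = T N F + \<iota> N (F N)"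
      by (auto simp: T_def \<iota>_def fun_eq_iff)
    have "L (T (Suc N) F) = L (T N F) + L (\<iota> N (F N))"
      unfolding * by (rule add[OF T \<iota>]) (use F in auto)
    then show ?case
      using Suc hL F by simp
  qed
  show thesis
  proof
    show "h j \<in> L2 (\<mu> j)" for j
      by (rule h)
    show "(\<Sum>j<N. L2_norm (\<mu> j) (h j) / \<kappa> j) \<le> C" for N
    proof -
      define a where "a j = L2_norm (\<mu> j) (h j)" for j
      define F where "F j x = complex_of_real (1 / (\<kappa> j * a j)) * cnj (h j x)" for j x
      have F: "F j \<in> L2 (\<mu> j)" for j
        unfolding F_def[abs_def] by (intro L2_scale L2_cnj h)
      have nF: "\<kappa> j * L2_norm (\<mu> j) (F j) \<le> 1" for j
      proof -
        have "L2_norm (\<mu> j) (F j) = cmod (complex_of_real (1 / (\<kappa> j * a j))) * a j"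
          unfolding F_def[abs_def] by (simp only: L2_norm_scale L2_norm_cnj a_def)
        also have "\<dots> = 1 / (\<kappa> j * a j) * a j"
          using \<kappa>[of j] by (simp only: norm_of_real) (simp add: a_def)
        finally show ?thesis
          using \<kappa>[of j] by (cases "a j = 0") auto
      qed
      have "Re (LINT x|\<mu> j. h j x * F j x) = a j / \<kappa> j" for j
      proof -
        have "h j x * F j x = complex_of_real (1 / (\<kappa> j * a j) * (cmod (h j x))\<^sup>2)" for x
          unfolding F_def of_real_mult[of _ "(cmod _)\<^sup>2"] complex_norm_square by (simp only: mult_ac)
        then have "(LINT x|\<mu> j. h j x * F j x) = (LINT x|\<mu> j. complex_of_real (1 / (\<kappa> j * a j) * (cmod (h j x))\<^sup>2))"
          by (simp only:)
        also have "\<dots> = complex_of_real (1 / (\<kappa> j * a j) * (a j)\<^sup>2)"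
          by (simp only: integral_complex_of_real integral_mult_right_zero a_def L2_norm_square)
        finally show ?thesis
          by (cases "a j = 0") (simp_all add: power2_eq_square)
      qed
      then have "(\<Sum>j<N. a j / \<kappa> j) = L (T N F)"
        using LT[OF F, of N] by simp
      also have "\<dots> \<le> C * c0_L2_norm \<mu> \<kappa> (T N F)"
        using F by (intro le T)
      also have "\<dots> \<le> C * 1"
        using nF C by (intro mult_left_mono c0_L2_norm_least) (auto simp: T_def)
      finally show ?thesis
        by (simp add: a_def)
    qed
    show "(\<lambda>j. Re (LINT x|\<mu> j. h j x * F j x)) sums L F" if F: "F \<in> c0_L2 \<mu> \<kappa>" for F
      unfolding sums_def
    proof (rule LIMSEQ_I)
      fix r :: real
      assume r: "0 < r"
      define e where "e = r / (C + 1)"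
      have e: "0 < e" "C * e < r"
        using r C by (auto simp: e_def field_simps)
      have "(\<lambda>j. \<kappa> j * L2_norm (\<mu> j) (F j)) \<longlonglongrightarrow> 0"
        using F by (simp add: c0_L2_def)
      from order_tendstoD(2)[OF this e(1)] obtain N0
        where N0: "\<And>j. N0 \<le> j \<Longrightarrow> \<kappa> j * L2_norm (\<mu> j) (F j) < e"
        by (auto simp: eventually_sequentially)
      have L: "F j \<in> L2 (\<mu> j)" for j
        using F by (simp add: c0_L2_def)
      have "\<bar>L (T N F) - L F\<bar> < r" if N: "N0 \<le> N" for N
      proof -
        have small: "L (c *\<^sub>R (F - T N F)) < r" if c: "\<bar>c\<bar> = 1" for c
        proof -
          have "c *\<^sub>R (F - T N F) \<in> c0_L2 \<mu> \<kappa>"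
            using S F T[OF L] by (simp add: subspace_diff subspace_scale)
          then have "L (c *\<^sub>R (F - T N F)) \<le> C * c0_L2_norm \<mu> \<kappa> (c *\<^sub>R (F - T N F))"
            by (rule le)
          also have "\<dots> \<le> C * e"
          proof (intro mult_left_mono C c0_L2_norm_least)
            show "\<kappa> j * L2_norm (\<mu> j) ((c *\<^sub>R (F - T N F)) j) \<le> e" for j
              using N0[of j] N e(1) c by (cases "j < N") (auto simp: T_def L2_norm_scaleR)
          qed
          finally show ?thesis
            using e(2) by simp
        qed
        have "L F = L (T N F) + L (F - T N F)"
          using add[OF T[OF L, where N = N], of "F - T N F"] S F T[OF L] by (simp add: subspace_diff)
        moreover have "L ((-1) *\<^sub>R (F - T N F)) = - L (F - T N F)"
          using scale[of "F - T N F" "-1"] S F T[OF L] by (simp add: subspace_diff)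
        ultimately show ?thesis
          using small[of 1] small[of "-1"] by simp
      qed
      then show "\<exists>no. \<forall>N\<ge>no. norm ((\<Sum>j<N. Re (LINT x|\<mu> j. h j x * F j x)) - L F) < r"
        using LT[OF L] by auto
    qed
  qed
qed

text \<open>
  The form used below: \<open>V\<close> sits diagonally in the \<open>c\<^sub>0\<close>-sum, each function being seen through all the
  measures \<open>\<mu> j\<close> at once. The real part of \<open>l\<close> is extended and represented; comparing the values at \<open>f\<close>
  and at \<open>\<i> f\<close> recovers the imaginary part.
\<close>
theorem c0_L2_subspace_dual:
  fixes V :: "('x \<Rightarrow> complex) set" and l :: "('x \<Rightarrow> complex) \<Rightarrow> complex"
  assumes C: "0 \<le> C"
    and V0: "(\<lambda>x. 0) \<in> V"
    and V_add: "\<And>f h. f \<in> V \<Longrightarrow> h \<in> V \<Longrightarrow> (\<lambda>x. f x + h x) \<in> V"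
    and V_scale: "\<And>c f. f \<in> V \<Longrightarrow> (\<lambda>x. c * f x) \<in> V"
    and V_c0: "\<And>f. f \<in> V \<Longrightarrow> (\<lambda>j. f) \<in> c0_L2 \<mu> \<kappa>"
    and l_add: "\<And>f h. f \<in> V \<Longrightarrow> h \<in> V \<Longrightarrow> l (\<lambda>x. f x + h x) = l f + l h"
    and l_scale: "\<And>c f. f \<in> V \<Longrightarrow> l (\<lambda>x. c * f x) = c * l f"
    and l_le: "\<And>f. f \<in> V \<Longrightarrow> cmod (l f) \<le> C * c0_L2_norm \<mu> \<kappa> (\<lambda>j. f)"
  obtains h where "\<And>j. h j \<in> L2 (\<mu> j)"
    and "\<And>N. (\<Sum>j<N. L2_norm (\<mu> j) (h j) / \<kappa> j) \<le> C"
    and "\<And>f. f \<in> V \<Longrightarrow> (\<lambda>j. LINT x|\<mu> j. h j x * f x) sums l f"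
proof -
  define V' where "V' = (\<lambda>f (j::nat). f) ` V"
  have V'I: "(\<lambda>j. f) \<in> V'" if "f \<in> V" for f
    using that by (auto simp: V'_def)
  have add': "(\<lambda>j::nat. f) + (\<lambda>j. h) = (\<lambda>j x. f x + h x)" for f h :: "'x \<Rightarrow> complex"
    by (simp add: fun_eq_iff)
  have scale': "c *\<^sub>R (\<lambda>j::nat. f) = (\<lambda>j x. complex_of_real c * f x)" for c and f :: "'x \<Rightarrow> complex"
    by (simp add: fun_eq_iff scaleR_conv_of_real)
  have hb1: "subspace V'"
    unfolding subspace_def
  proof (intro conjI ballI allI)
    show "0 \<in> V'"
      using V'I[OF V0] by (simp add: zero_fun_def)
    show "F + G \<in> V'" if "F \<in> V'" "G \<in> V'" for F G
      using that V_add by (auto simp: V'_def add')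
    show "c *\<^sub>R F \<in> V'" if "F \<in> V'" for c F
      using that V_scale by (auto simp: V'_def scale')
  qed
  have hb2: "V' \<subseteq> c0_L2 \<mu> \<kappa>"
    using V_c0 by (auto simp: V'_def)
  have hb3: "C * c0_L2_norm \<mu> \<kappa> (F + G) \<le> C * c0_L2_norm \<mu> \<kappa> F + C * c0_L2_norm \<mu> \<kappa> G"
    if "F \<in> c0_L2 \<mu> \<kappa>" "G \<in> c0_L2 \<mu> \<kappa>" for F G
    using mult_left_mono[OF c0_L2_norm_triangle[OF that] C] by (simp add: distrib_left)
  have hb4: "C * c0_L2_norm \<mu> \<kappa> (c *\<^sub>R F) = c * (C * c0_L2_norm \<mu> \<kappa> F)"
    if "0 < c" "F \<in> c0_L2 \<mu> \<kappa>" for c F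
    using that by (simp add: c0_L2_norm_scaleR)
  have hb5: "Re (l ((F + G) 0)) = Re (l (F 0)) + Re (l (G 0))" if "F \<in> V'" "G \<in> V'" for F G
    using that l_add by (auto simp: V'_def plus_fun_def)
  have hb6: "Re (l ((c *\<^sub>R F) 0)) = c * Re (l (F 0))" if "F \<in> V'" for c F
    using that l_scale by (auto simp: V'_def scaleR_fun_def scaleR_conv_of_real)
  have hb7: "Re (l (F 0)) \<le> C * c0_L2_norm \<mu> \<kappa> F" if "F \<in> V'" for F
    using that l_le order_trans[OF complex_Re_le_cmod] by (auto simp: V'_def)
  obtain L where
    L: "\<And>F G. F \<in> c0_L2 \<mu> \<kappa> \<Longrightarrow> G \<in> c0_L2 \<mu> \<kappa> \<Longrightarrow> L (F + G) = L F + L G"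
      "\<And>c F. F \<in> c0_L2 \<mu> \<kappa> \<Longrightarrow> L (c *\<^sub>R F) = c * L F"
      "\<And>F. F \<in> c0_L2 \<mu> \<kappa> \<Longrightarrow> L F \<le> C * c0_L2_norm \<mu> \<kappa> F"
    and Ll: "\<And>F. F \<in> V' \<Longrightarrow> L F = Re (l (F 0))"
    by (rule hahn_banach_real[OF subspace_c0_L2 hb1 hb2, where p = "\<lambda>F. C * c0_L2_norm \<mu> \<kappa> F"
          and l = "\<lambda>F. Re (l (F 0))", OF hb3 hb4 hb5 hb6 hb7]) blast+
  obtain h where h: "\<And>j. h j \<in> L2 (\<mu> j)"
    and hC: "\<And>N. (\<Sum>j<N. L2_norm (\<mu> j) (h j) / \<kappa> j) \<le> C"
    and hL: "\<And>F. F \<in> c0_L2 \<mu> \<kappa> \<Longrightarrow> (\<lambda>j. Re (LINT x|\<mu> j. h j x * F j x)) sums L F"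
    using c0_L2_functional[OF C L] by blast
  have Re_l: "(\<lambda>j. Re (LINT x|\<mu> j. h j x * f x)) sums Re (l f)" if "f \<in> V" for f
    using hL[OF V_c0[OF that]] Ll[OF V'I[OF that]] by simp
  show thesis
  proof
    show "h j \<in> L2 (\<mu> j)" "(\<Sum>j<N. L2_norm (\<mu> j) (h j) / \<kappa> j) \<le> C" for j N
      by (fact h, fact hC)
    show "(\<lambda>j. LINT x|\<mu> j. h j x * f x) sums l f" if f: "f \<in> V" for f
    proof -
      have "(LINT x|\<mu> j. h j x * (\<i> * f x)) = \<i> * (LINT x|\<mu> j. h j x * f x)" for j
        by (simp add: mult.left_commute[of _ \<i>])
      then have "(\<lambda>j. - Im (LINT x|\<mu> j. h j x * f x)) sums - Im (l f)"
        using Re_l[OF V_scale[OF f, of \<i>]] by (simp add: l_scale[OF f])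
      then have "(\<lambda>j. Im (LINT x|\<mu> j. h j x * f x)) sums Im (l f)"
        using sums_minus by fastforce
      then show ?thesis
        using Re_l[OF f] by (simp add: sums_complex_iff)
    qed
  qed
qed

end

section \<open>The Orlicz function and the weight of a ball\<close>

text \<open>
  The factor \<open>\<kappa>(r)\<close> that relates the norm of \<open>T_inf\<close> to norms in \<open>L\<^sup>2\<close> of tents, for a ball of radius
  \<open>r\<close> in dimension \<open>n\<close>.
\<close>
definition tent_weight :: "nat \<Rightarrow> (real \<Rightarrow> real) \<Rightarrow> real \<Rightarrow> real" where
  "tent_weight n \<omega> r = (let t = unit_ball_vol n * r ^ n in 1 / (orlicz_rho \<omega> t * sqrt t))"

text \<open>
  The decay index is nonnegative, so the quotient that bounds the lower type index from below is
  nonnegative too and the index is strictly positive.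
\<close>
lemma orlicz_lower_type_positive:
  assumes "decay_bound n g" "orlicz_standing n (decay_index n g) \<omega>"
  obtains p where "0 < p" "lower_type p \<omega>"
proof -
  have "decay_index n g \<ge> 0"
  proof -
    obtain \<epsilon> where \<epsilon>: "\<epsilon> > 0" "((\<lambda>r. r powr (real n + \<epsilon>) * g r) \<longlongrightarrow> 0) at_top"
      using assms(1) by (auto simp: decay_bound_def)
    then have "ereal \<epsilon> \<le> decay_index n g"
      unfolding decay_index_def by (intro Sup_upper) auto
    then show ?thesis
      using \<epsilon>(1) by (meson ereal_less_eq(5) less_imp_le order_trans)
  qed
  then have "0 \<le> ereal (real n) / (ereal (real n) + decay_index n g)"
    by (intro zero_le_divide_ereal) auto
  also have "\<dots> < lower_type_index \<omega>"
    using assms(2) by (simp add: orlicz_standing_def)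
  finally have "\<exists>q\<in>{ereal p | p. p > 0 \<and> lower_type p \<omega>}. 0 < q"
    unfolding lower_type_index_def by (simp add: less_Sup_iff)
  then show thesis
    using that by auto
qed

lemma exists_powr_le:
  fixes p e :: real
  assumes "0 < p" "0 < e"
  obtains t where "0 < t" "t \<le> 1" "t powr p \<le> e"
proof
  define t where "t = min 1 (e powr (1 / p))"
  show "0 < t" "t \<le> 1"
    using assms by (simp_all add: t_def)
  have "t powr p \<le> (e powr (1 / p)) powr p"
    using assms by (intro powr_mono2) (simp_all add: t_def)
  also have "\<dots> = e"
    using assms by (simp add: powr_powr)
  finally show "t powr p \<le> e" .
qed

text \<open>
  The two types of \<open>\<omega>\<close> with the exponent \<open>p\<close> of the lower one fixed, so that the inverse of \<open>\<omega>\<close> and the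
  weights can be studied in one context.
\<close>
locale orlicz_function =
  fixes \<omega> :: "real \<Rightarrow> real" and p :: real
  assumes pos: "\<And>t. 0 < t \<Longrightarrow> 0 < \<omega> t"
    and cont: "continuous_on {0<..} \<omega>"
    and mono: "strict_mono_on {0<..} \<omega>"
    and upper: "upper_type 1 \<omega>"
    and p: "0 < p" and lower: "lower_type p \<omega>"
begin

text \<open>
  The lower type inequality at the base point 1 shows that \<open>\<omega> t\<close> is small and \<open>\<omega> (1 / t)\<close> is large when
  \<open>t\<close> is small; the intermediate value theorem does the rest.
\<close>
lemma orlicz_surj:
  assumes "0 < u"
  obtains s where "0 < s" "\<omega> s = u"
proof -
  obtain C where C: "C > 0" and low: "\<And>s t. 0 < s \<Longrightarrow> 0 < t \<Longrightarrow> t \<le> 1 \<Longrightarrow> \<omega> (s * t) \<le> C * t powr p * \<omega> s"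
    using lower by (auto simp: lower_type_def)
  have w1: "0 < \<omega> 1"
    using pos by simp
  have "0 < min (u / (C * \<omega> 1)) (\<omega> 1 / (C * u))"
    using assms C w1 by simp
  then obtain t where t: "0 < t" "t \<le> 1" and "t powr p \<le> min (u / (C * \<omega> 1)) (\<omega> 1 / (C * u))"
    using exists_powr_le[OF p] by blast
  then have tp: "t powr p \<le> u / (C * \<omega> 1)" "t powr p \<le> \<omega> 1 / (C * u)"
    by simp_all
  have "\<omega> t \<le> C * t powr p * \<omega> 1"
    using low[of 1 t] t by simp
  also have "\<dots> \<le> u"
    using tp(1) C w1 by (simp add: field_simps)
  finally have lo: "\<omega> t \<le> u" .
  have "\<omega> 1 \<le> C * t powr p * \<omega> (1 / t)"
    using low[of "1 / t" t] t by simp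
  also have "\<dots> \<le> C * (\<omega> 1 / (C * u)) * \<omega> (1 / t)"
    using tp(2) C pos[of "1 / t"] t by (intro mult_right_mono mult_left_mono) auto
  finally have hi: "u \<le> \<omega> (1 / t)"
    using C w1 assms by (simp add: field_simps)
  have "t \<le> 1 / t"
    using t by (smt (verit) le_divide_eq_1_pos)
  moreover have "continuous_on {t..1 / t} \<omega>"
    using t by (intro continuous_on_subset[OF cont]) auto
  ultimately obtain s where "t \<le> s" "\<omega> s = u"
    using IVT'[of \<omega> t u "1 / t"] lo hi by auto
  then show thesis
    using that[of s] t by simp
qed

definition orlicz_inv :: "real \<Rightarrow> real" where
  "orlicz_inv u = the_inv_into {0<..} \<omega> u"

lemma inj: "inj_on \<omega> {0<..}"
  using mono by (rule strict_mono_on_imp_inj_on)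

lemma orlicz_inv:
  assumes "0 < u"
  shows "0 < orlicz_inv u" "\<omega> (orlicz_inv u) = u"
proof -
  obtain s where s: "0 < s" "\<omega> s = u"
    using orlicz_surj[OF assms] .
  then have "orlicz_inv u = s"
    unfolding orlicz_inv_def using the_inv_into_f_f[OF inj, of s] by simp
  then show "0 < orlicz_inv u" "\<omega> (orlicz_inv u) = u"
    using s by simp_all
qed

lemma le_orlicz_inv_iff:
  assumes "0 < u" "0 < s"
  shows "s \<le> orlicz_inv u \<longleftrightarrow> \<omega> s \<le> u"
  using strict_mono_on_less_eq[OF mono, of s "orlicz_inv u"] orlicz_inv[OF assms(1)] assms by simp

lemma orlicz_inv_mono:
  assumes "0 < u" "u \<le> v"
  shows "orlicz_inv u \<le> orlicz_inv v"
  using assms orlicz_inv[of u] le_orlicz_inv_iff[of v "orlicz_inv u"] by simp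

text \<open>
  Upper type 1 means that \<open>\<omega>\<close> is at least linear near 0, hence its inverse is at most linear there.
\<close>
lemma orlicz_inv_linear_bound:
  obtains C where "0 < C" "\<And>u. 0 < u \<Longrightarrow> u \<le> \<omega> 1 \<Longrightarrow> orlicz_inv u \<le> C * u"
proof -
  obtain C where C: "C > 0" and up: "\<And>s t. 0 < s \<Longrightarrow> 1 \<le> t \<Longrightarrow> \<omega> (s * t) \<le> C * t powr 1 * \<omega> s"
    using upper by (auto simp: upper_type_def)
  have w1: "0 < \<omega> 1"
    using pos by simp
  show thesis
  proof
    show "0 < C / \<omega> 1"
      using C w1 by simp
    show "orlicz_inv u \<le> C / \<omega> 1 * u" if u: "0 < u" "u \<le> \<omega> 1" for u
    proof -
      have le1: "orlicz_inv u \<le> 1"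
        using strict_mono_on_less_eq[OF mono, of "orlicz_inv u" 1] orlicz_inv[OF u(1)] u by simp
      have "\<omega> 1 \<le> C * (1 / orlicz_inv u) powr 1 * \<omega> (orlicz_inv u)"
        using up[of "orlicz_inv u" "1 / orlicz_inv u"] orlicz_inv(1)[OF u(1)] le1 by simp
      then show ?thesis
        using orlicz_inv[OF u(1)] w1 by (simp add: field_simps)
    qed
  qed
qed

text \<open>
  Lower type \<open>p\<close> says that multiplying the argument of \<open>\<omega>\<close> by a suitable \<open>t \<le> 1\<close> divides the value
  by at least \<open>K\<close>.
\<close>
lemma orlicz_inv_doubling:
  assumes "1 \<le> K"
  obtains C where "0 < C" "\<And>u. 0 < u \<Longrightarrow> orlicz_inv u \<le> C * orlicz_inv (u / K)"
proof -
  obtain C where C: "C > 0" and low: "\<And>s t. 0 < s \<Longrightarrow> 0 < t \<Longrightarrow> t \<le> 1 \<Longrightarrow> \<omega> (s * t) \<le> C * t powr p * \<omega> s"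
    using lower by (auto simp: lower_type_def)
  have "0 < 1 / (C * K)"
    using assms C by simp
  then obtain t where t: "0 < t" "t \<le> 1" and "t powr p \<le> 1 / (C * K)"
    using exists_powr_le[OF p] by blast
  then have tp: "C * t powr p \<le> 1 / K"
    using C assms by (simp add: field_simps)
  show thesis
  proof
    show "0 < 1 / t"
      using t by simp
    show "orlicz_inv u \<le> 1 / t * orlicz_inv (u / K)" if u: "0 < u" for u
    proof -
      have "\<omega> (orlicz_inv u * t) \<le> C * t powr p * u"
        using low[of "orlicz_inv u" t] orlicz_inv[OF u] t by simp
      also have "\<dots> \<le> 1 / K * u"
        using tp u by (intro mult_right_mono) auto
      finally have "orlicz_inv u * t \<le> orlicz_inv (u / K)"
        using le_orlicz_inv_iff[of "u / K" "orlicz_inv u * t"] u assms t orlicz_inv[OF u] by simp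
      then show ?thesis
        using t by (simp add: field_simps)
    qed
  qed
qed

text \<open>
  With \<open>v\<close> the volume of the ball, the definition of \<open>\<rho>\<close> turns the weight into
  the product of \<open>sqrt v\<close> and the inverse of \<open>\<omega>\<close> at \<open>1 / v\<close>, from which its growth is read off.
\<close>
lemma tent_weight_eq:
  assumes "0 < r"
  shows "tent_weight n \<omega> r = sqrt (unit_ball_vol n * r ^ n) * orlicz_inv (1 / (unit_ball_vol n * r ^ n))"
proof -
  define t where "t = unit_ball_vol n * r ^ n"
  have t: "0 < t"
    using assms by (simp add: t_def)
  have "1 / (orlicz_rho \<omega> t * sqrt t) = t / sqrt t * orlicz_inv (1 / t)"
    using t by (simp add: orlicz_rho_def orlicz_inv_def inverse_eq_divide)
  then show ?thesis
    using t by (simp add: tent_weight_def t_def[symmetric] real_div_sqrt)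
qed

lemma tent_weight_pos: "0 < r \<Longrightarrow> 0 < tent_weight n \<omega> r"
  by (auto simp: tent_weight_eq intro!: mult_pos_pos orlicz_inv)

lemma tent_weight_doubling:
  assumes K: "1 \<le> K"
  obtains C where "0 < C" "\<And>r s. 0 < r \<Longrightarrow> r \<le> s \<Longrightarrow> s \<le> K * r \<Longrightarrow> tent_weight n \<omega> r \<le> C * tent_weight n \<omega> s"
proof -
  obtain C where C: "0 < C" "\<And>u. 0 < u \<Longrightarrow> orlicz_inv u \<le> C * orlicz_inv (u / K ^ n)"
    using orlicz_inv_doubling[of "K ^ n"] K by auto
  show thesis
  proof
    show "0 < C"
      by fact
    fix r s :: real
    assume rs: "0 < r" "r \<le> s" "s \<le> K * r"
    define t t' where "t = unit_ball_vol n * r ^ n" and "t' = unit_ball_vol n * s ^ n"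
    have t: "0 < t" "t \<le> t'"
      using rs by (auto simp: t_def t'_def intro!: mult_left_mono power_mono)
    have "s ^ n \<le> (K * r) ^ n"
      using rs by (intro power_mono) auto
    then have t': "t' \<le> t * K ^ n"
      by (simp add: t_def t'_def power_mult_distrib mult_ac)
    have "1 / t / K ^ n \<le> 1 / t'"
      using t t' K by (simp add: field_simps)
    then have "orlicz_inv (1 / t / K ^ n) \<le> orlicz_inv (1 / t')"
      using t K by (intro orlicz_inv_mono) auto
    then have "orlicz_inv (1 / t) \<le> C * orlicz_inv (1 / t')"
      using C(2)[of "1 / t"] t C(1) by (smt (verit) mult_left_mono zero_less_divide_1_iff)
    moreover have "sqrt t \<le> sqrt t'" "0 \<le> C * orlicz_inv (1 / t')"
      using t C(1) orlicz_inv(1)[of "1 / t'"] by auto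
    ultimately have "sqrt t * orlicz_inv (1 / t) \<le> sqrt t' * (C * orlicz_inv (1 / t'))"
      using orlicz_inv(1)[of "1 / t"] t by (intro mult_mono) auto
    then show "tent_weight n \<omega> r \<le> C * tent_weight n \<omega> s"
      using rs by (simp add: tent_weight_eq t_def[symmetric] t'_def[symmetric] mult_ac)
  qed
qed

text \<open>
  For large volumes \<open>v\<close> the linear bound on the inverse of \<open>\<omega>\<close> leaves a multiple of \<open>1 / sqrt v\<close>.
\<close>
lemma tent_weight_tendsto_0:
  assumes n: "0 < n"
  shows "(tent_weight n \<omega> \<longlongrightarrow> 0) at_top"
proof -
  obtain C where C: "0 < C" "\<And>u. 0 < u \<Longrightarrow> u \<le> \<omega> 1 \<Longrightarrow> orlicz_inv u \<le> C * u"
    using orlicz_inv_linear_bound by blast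
  define vol where "vol r = unit_ball_vol n * r ^ n" for r :: real
  have vol: "filterlim vol at_top at_top"
    unfolding vol_def[abs_def]
    by (rule filterlim_tendsto_pos_mult_at_top[OF tendsto_const _ filterlim_pow_at_top[OF n filterlim_ident]]) simp
  show ?thesis
  proof (rule Lim_null_comparison)
    show "\<forall>\<^sub>F r in at_top. norm (tent_weight n \<omega> r) \<le> C * inverse (sqrt (vol r))"
      using eventually_gt_at_top[of 0] filterlim_at_top_dense[THEN iffD1, OF vol, rule_format, of "1 / \<omega> 1"]
    proof eventually_elim
      case (elim r)
      have "0 < vol r"
        using elim(1) by (simp add: vol_def)
      then have "orlicz_inv (1 / vol r) \<le> C * (1 / vol r)"
        using elim(2) pos[of 1] by (intro C(2)) (auto simp: field_simps)
      then have "sqrt (vol r) * orlicz_inv (1 / vol r) \<le> sqrt (vol r) * (C * (1 / vol r))"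
        using \<open>0 < vol r\<close> by (intro mult_left_mono) auto
      also have "\<dots> = C * inverse (sqrt (vol r))"
        using \<open>0 < vol r\<close> by (simp add: field_simps flip: real_sqrt_mult)
      finally show ?case
        using elim(1) tent_weight_pos[of r n] by (simp add: tent_weight_eq vol_def)
    qed
    have "((\<lambda>r. inverse (sqrt (vol r))) \<longlongrightarrow> 0) at_top"
      by (intro tendsto_inverse_0_at_top filterlim_compose[OF sqrt_at_top vol])
    then show "((\<lambda>r. C * inverse (sqrt (vol r))) \<longlongrightarrow> 0) at_top"
      by (rule tendsto_mult_right_zero)
  qed
qed

end

section \<open>A locally finite net of balls, and tents over balls\<close>

definition integer_lattice :: "'a::euclidean_space set" where
  "integer_lattice = {z. \<forall>b\<in>Basis. z \<bullet> b \<in> \<int>}"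

lemma finite_integer_lattice_bounded: "finite {z \<in> integer_lattice. norm (z::'a::euclidean_space) \<le> R}"
proof -
  have "x = y" if "x \<in> integer_lattice" "y \<in> integer_lattice" "dist x y < 1" for x y :: 'a
  proof (rule euclidean_eqI)
    fix b :: 'a
    assume b: "b \<in> Basis"
    have "(x - y) \<bullet> b \<in> \<int>"
      using that b by (auto simp: integer_lattice_def inner_diff_left)
    moreover have "\<bar>(x - y) \<bullet> b\<bar> < 1"
      using Basis_le_norm[OF b, of "x - y"] that(3) by (simp add: dist_norm)
    ultimately have "(x - y) \<bullet> b = 0"
      by (simp add: Ints_eq_abs_less1[of _ 0])
    then show "x \<bullet> b = y \<bullet> b"
      by (simp add: inner_diff_left)
  qed
  then have "uniform_discrete {z \<in> integer_lattice. norm (z::'a) \<le> R}"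
    unfolding uniform_discrete_def by (intro exI[of _ 1]) auto
  moreover have "bounded {z \<in> integer_lattice. norm (z::'a) \<le> R}"
    by (rule boundedI[of _ R]) auto
  ultimately show ?thesis
    using uniform_discrete_finite_iff by blast
qed

lemma countable_integer_lattice: "countable (integer_lattice :: 'a::euclidean_space set)"
proof -
  have "(integer_lattice :: 'a set) \<subseteq> (\<Union>N::nat. {z \<in> integer_lattice. norm z \<le> real N})"
  proof
    fix z :: 'a
    assume "z \<in> integer_lattice"
    moreover obtain N :: nat where "norm z \<le> real N"
      using real_arch_simple by blast
    ultimately show "z \<in> (\<Union>N::nat. {z \<in> integer_lattice. norm z \<le> real N})"
      by blast
  qed
  moreover have "countable (\<Union>N::nat. {z \<in> integer_lattice. norm (z::'a) \<le> real N})"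
    by (rule countable_UN[OF countableI_type countable_finite[OF finite_integer_lattice_bounded]])
  ultimately show ?thesis
    by (rule countable_subset)
qed

lemma integer_lattice_near: "\<exists>z\<in>integer_lattice. dist x z \<le> real DIM('a)" for x :: "'a::euclidean_space"
proof
  define z where "z = (\<Sum>b\<in>Basis. of_int \<lfloor>x \<bullet> b\<rfloor> *\<^sub>R b)"
  have z: "z \<bullet> b = of_int \<lfloor>x \<bullet> b\<rfloor>" if "b \<in> Basis" for b
    using that by (simp add: z_def)
  then show "z \<in> integer_lattice"
    by (simp add: integer_lattice_def)
  have "dist x z \<le> (\<Sum>b\<in>Basis. \<bar>(x - z) \<bullet> b\<bar>)"
    unfolding dist_norm by (rule norm_le_l1)
  also have "\<dots> \<le> (\<Sum>b\<in>(Basis::'a set). 1)"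
  proof (rule sum_mono)
    fix b :: 'a
    assume "b \<in> Basis"
    then show "\<bar>(x - z) \<bullet> b\<bar> \<le> 1"
      using z by (simp add: inner_diff_left) linarith
  qed
  finally show "dist x z \<le> real DIM('a)"
    by simp
qed

lemma dyadic_between:
  fixes s :: real
  assumes "0 < s"
  obtains k :: int where "s \<le> 2 powr k" "2 powr k \<le> 2 * s"
proof
  define k where "k = \<lceil>log 2 s\<rceil>"
  have "2 powr log 2 s \<le> 2 powr k"
    by (intro powr_mono) (auto simp: k_def)
  then show "s \<le> 2 powr k"
    using assms by simp
  have "2 powr k \<le> 2 powr (1 + log 2 s)"
    unfolding k_def by (intro powr_mono) linarith+
  also have "\<dots> = 2 * s"
    using assms by (simp add: powr_add)
  finally show "2 powr k \<le> 2 * s" .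
qed

text \<open>
  The balls have centres in \<open>2\<^sup>k \<int>\<^sup>n\<close> and radius \<open>(n + 1) 2\<^sup>k\<close>. Given a ball of radius \<open>s\<close>, choose \<open>k\<close>
  with \<open>s \<le> 2\<^sup>k \<le> 2 s\<close>; a lattice point lies within \<open>n 2\<^sup>k\<close> of its centre. The containment of balls is
  expressed by the distance of the centres, which also yields the containment of the tents. In the
  last statement the bounds on the radius leave finitely many \<open>k\<close>, and for each of them the bound on
  the centre leaves finitely many lattice points.
\<close>
lemma locally_finite_ball_net:
  obtains c :: "nat \<Rightarrow> 'a::euclidean_space" and r :: "nat \<Rightarrow> real" and K :: real
  where "\<And>j. 0 < r j" and "1 \<le> K"
    and "\<And>x s. 0 < s \<Longrightarrow> \<exists>j. dist x (c j) + s \<le> r j \<and> r j \<le> K * s"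
    and "\<And>R. finite {j. 1 / R \<le> r j \<and> r j \<le> R \<and> norm (c j) \<le> R}"
proof -
  define n where "n = real DIM('a)"
  have n: "1 \<le> n"
    by (simp add: n_def Suc_leI)
  define I where "I = (UNIV :: int set) \<times> (integer_lattice :: 'a set)"
  have I: "countable I" "infinite I"
    unfolding I_def using integer_lattice_near[of "0::'a"]
    by (auto simp: finite_cartesian_product_iff infinite_UNIV_int intro: countable_SIGMA countable_integer_lattice)
  define e where "e = from_nat_into I"
  have e: "bij_betw e UNIV I"
    unfolding e_def using I by (rule bij_betw_from_nat_into)
  define c where "c j = (2 powr fst (e j)) *\<^sub>R snd (e j)" for j
  define r where "r j = (n + 1) * 2 powr fst (e j)" for j
  show thesis
  proof
    show "0 < r j" for j
      using n by (simp add: r_def)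
    show "1 \<le> 2 * (n + 1)"
      using n by simp
    show "\<exists>j. dist x (c j) + s \<le> r j \<and> r j \<le> 2 * (n + 1) * s" if s: "0 < s" for x s
    proof -
      obtain k :: int where k: "s \<le> 2 powr k" "2 powr k \<le> 2 * s"
        using dyadic_between[OF s] .
      define d where "d = 2 powr real_of_int k"
      have d: "d > 0"
        by (simp add: d_def)
      obtain z where z: "z \<in> integer_lattice" "dist ((1 / d) *\<^sub>R x) z \<le> n"
        using integer_lattice_near[of "(1 / d) *\<^sub>R x"] by (auto simp: n_def)
      have "x - d *\<^sub>R z = d *\<^sub>R ((1 / d) *\<^sub>R x - z)"
        using d by (simp add: algebra_simps)
      then have "dist x (d *\<^sub>R z) = d * dist ((1 / d) *\<^sub>R x) z"
        using d by (simp add: dist_norm)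
      also have "\<dots> \<le> d * n"
        using z d by (intro mult_left_mono) auto
      finally have "dist x (d *\<^sub>R z) + s \<le> (n + 1) * d"
        using k(1) by (simp add: d_def algebra_simps)
      moreover have "(n + 1) * d \<le> 2 * (n + 1) * s"
        using k(2) n mult_left_mono[of d "2 * s" "n + 1"] by (simp add: d_def algebra_simps)
      moreover have "(k, z) \<in> range e"
        using e z by (auto simp: bij_betw_def I_def)
      then obtain j where "e j = (k, z)"
        by (metis imageE)
      ultimately show ?thesis
        by (intro exI[of _ j]) (simp add: c_def r_def d_def)
    qed
    show "finite {j. 1 / R \<le> r j \<and> r j \<le> R \<and> norm (c j) \<le> R}" for R
    proof -
      define J where "J = {j. 1 / R \<le> r j \<and> r j \<le> R \<and> norm (c j) \<le> R}"
      have "e ` J \<subseteq> {\<lfloor>log 2 (1 / (R * (n + 1)))\<rfloor>..\<lceil>log 2 R\<rceil>} \<times> {z \<in> integer_lattice. norm z \<le> R * (R * (n + 1))}"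
      proof
        fix y
        assume "y \<in> e ` J"
        then obtain j where j: "1 / R \<le> r j" "r j \<le> R" "norm (c j) \<le> R" and y: "y = e j"
          by (auto simp: J_def)
        obtain k z where kz: "e j = (k, z)"
          by fastforce
        have "(k, z) \<in> I"
          using e kz by (metis bij_betwE iso_tuple_UNIV_I)
        then have z: "z \<in> integer_lattice"
          by (simp add: I_def)
        define d where "d = 2 powr real_of_int k"
        have d: "0 < d"
          by (simp add: d_def)
        have j': "1 / R \<le> (n + 1) * d" "(n + 1) * d \<le> R" "d * norm z \<le> R"
          using j by (simp_all add: r_def c_def kz d_def)
        have R: "0 < R"
          using j'(2) d n by (smt (verit) mult_pos_pos)
        have q: "0 < R * (n + 1)"
          using R n by simp
        have "1 \<le> (n + 1) * d * R"
          using j'(1) R by (simp only: pos_divide_le_eq)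
        then have d1: "1 / (R * (n + 1)) \<le> d"
          by (simp only: pos_divide_le_eq[OF q] mult_ac)
        have "1 * d \<le> (n + 1) * d"
          using n d by (intro mult_right_mono) auto
        then have d2: "d \<le> R"
          using j'(2) by linarith
        have logd: "log 2 d = real_of_int k"
          by (simp add: d_def)
        have "log 2 (1 / (R * (n + 1))) \<le> real_of_int k"
          unfolding logd[symmetric] using d1 R n d by (intro log_mono) auto
        moreover have "real_of_int k \<le> log 2 R"
          unfolding logd[symmetric] using d2 R d by (intro log_mono) auto
        moreover have "norm z \<le> R * (R * (n + 1))"
        proof -
          have "1 / (R * (n + 1)) * norm z \<le> R"
            using mult_right_mono[OF d1, of "norm z"] j'(3) by simp
          then have "norm z / (R * (n + 1)) \<le> R"
            by simp
          then show ?thesis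
            by (simp only: pos_divide_le_eq[OF q])
        qed
        ultimately show "y \<in> {\<lfloor>log 2 (1 / (R * (n + 1)))\<rfloor>..\<lceil>log 2 R\<rceil>} \<times> {z \<in> integer_lattice. norm z \<le> R * (R * (n + 1))}"
          using z by (simp add: y kz) linarith
      qed
      then have "finite (e ` J)"
        by (rule finite_subset) (intro finite_cartesian_product finite_atLeastAtMost_int finite_integer_lattice_bounded)
      moreover have "inj_on e J"
        using e by (auto simp: bij_betw_def intro: inj_on_subset)
      ultimately show ?thesis
        unfolding J_def by (rule finite_imageD)
    qed
  qed
qed

text \<open>
  A point \<open>(y, t)\<close> avoids all cones with vertex outside an open set iff the ball about \<open>y\<close> of radius \<open>t\<close>
  is contained in that set.
\<close>
lemma mem_tent_ball_iff:
  "(y, t) \<in> tent (ball x r) \<longleftrightarrow> 0 < t \<and> dist x y + t \<le> r" for x :: "'a::euclidean_space"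
proof -
  have "(y, t) \<in> tent (ball x r) \<longleftrightarrow> 0 < t \<and> ball y t \<subseteq> ball x r"
    by (auto simp: tent_def cone_at_def half_space_def dist_commute subset_iff)
  then show ?thesis
    by (auto simp: ball_subset_ball_iff dist_commute)
qed

lemma tent_ball_mono:
  fixes x y :: "'a::euclidean_space"
  assumes "dist x y + r \<le> s"
  shows "tent (ball x r) \<subseteq> tent (ball y s)"
proof
  fix p assume "p \<in> tent (ball x r)"
  then show "p \<in> tent (ball y s)"
    using assms dist_triangle[of y "fst p" x]
    by (cases p) (auto simp: mem_tent_ball_iff dist_commute)
qed

lemma sets_tent_ball [measurable]: "tent (ball x r) \<in> sets tent_measure" for x :: "'a::euclidean_space"
proof -
  have eq: "tent (ball x r) = {p. 0 < snd p} \<inter> {p. dist x (fst p) + snd p \<le> r}"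
    by (auto simp: mem_tent_ball_iff)
  have half: "half_space = {p :: 'a \<times> real. 0 < snd p}"
    by (auto simp: half_space_def)
  have op: "open {p :: 'a \<times> real. 0 < snd p}"
    by (intro open_Collect_less continuous_intros)
  have cl: "closed {p. dist x (fst p) + snd p \<le> r}"
    by (intro closed_Collect_le continuous_intros)
  have "tent (ball x r) \<in> sets borel"
    unfolding eq using op cl by auto
  moreover have "(half_space :: ('a \<times> real) set) \<in> sets borel"
    unfolding half using op by auto
  ultimately show ?thesis
    by (auto simp: tent_measure_def sets_restrict_space_iff eq half)
qed

text \<open>
  The restriction of \<open>M\<close> to \<open>A\<close> as a density: unlike a subspace measure it keeps the space and the
  measurable functions, so that one function can be compared on different tents.
\<close>
definition density_on :: "'x measure \<Rightarrow> 'x set \<Rightarrow> 'x measure" where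
  "density_on M A = density M (\<lambda>x. ennreal (indicator A x))"

lemma L2_density_on_iff:
  assumes [measurable]: "A \<in> sets M"
  shows "f \<in> L2 (density_on M A) \<longleftrightarrow>
    f \<in> borel_measurable M \<and> set_integrable M A (\<lambda>x. (cmod (f x))\<^sup>2)"
proof (cases "f \<in> borel_measurable M")
  case True
  then have [measurable]: "f \<in> borel_measurable M" .
  show ?thesis
    unfolding L2_def density_on_def set_integrable_def
    by (subst mem_Collect_eq, subst integrable_density) auto
qed (simp add: L2_def density_on_def)

lemma L2_norm_density_on:
  assumes [measurable]: "A \<in> sets M" "f \<in> borel_measurable M"
  shows "L2_norm (density_on M A) f = sqrt (LINT x:A|M. (cmod (f x))\<^sup>2)"
  unfolding L2_norm_def density_on_def set_lebesgue_integral_def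
  by (subst integral_density) auto

lemma density_on_integral_eq:
  fixes f :: "'x \<Rightarrow> complex"
  assumes [measurable]: "A \<in> sets M" "f \<in> borel_measurable M" and "AE x in M. x \<notin> A \<longrightarrow> f x = 0"
  shows "integrable (density_on M A) f \<longleftrightarrow> integrable M f"
    and "(LINT x|density_on M A. f x) = (LINT x|M. f x)"
proof -
  have AE: "AE x in M. indicator A x *\<^sub>R f x = f x"
    using assms(3) by eventually_elim (auto simp: indicator_def)
  show "integrable (density_on M A) f \<longleftrightarrow> integrable M f"
    unfolding density_on_def
    by (subst integrable_density) (auto intro!: integrable_cong_AE[THEN iffD1, OF _ _ AE]
        integrable_cong_AE[THEN iffD2, OF _ _ AE])
  show "(LINT x|density_on M A. f x) = (LINT x|M. f x)"
    unfolding density_on_def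
    by (subst integral_density) (auto intro!: integral_cong_AE AE)
qed

lemma L2_norm_density_on_mono:
  assumes A [measurable]: "A \<in> sets M" and B [measurable]: "B \<in> sets M"
    and f: "f \<in> L2 (density_on M A)" "f \<in> L2 (density_on M B)"
    and AE: "AE x in M. x \<in> A \<longrightarrow> x \<notin> B \<longrightarrow> f x = 0"
  shows "L2_norm (density_on M A) f \<le> L2_norm (density_on M B) f"
proof -
  have m: "f \<in> borel_measurable M" and iA: "set_integrable M A (\<lambda>x. (cmod (f x))\<^sup>2)"
    and iB: "set_integrable M B (\<lambda>x. (cmod (f x))\<^sup>2)"
    using f by (auto simp: L2_density_on_iff A B)
  have "(LINT x:A|M. (cmod (f x))\<^sup>2) \<le> (LINT x:B|M. (cmod (f x))\<^sup>2)"
    unfolding set_lebesgue_integral_def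
  proof (rule integral_mono_AE)
    show "AE x in M. indicator A x *\<^sub>R (cmod (f x))\<^sup>2 \<le> indicator B x *\<^sub>R (cmod (f x))\<^sup>2"
      using AE by eventually_elim (auto simp: indicator_def)
  qed (use iA iB in \<open>simp_all add: set_integrable_def\<close>)
  then show ?thesis
    by (simp add: L2_norm_density_on A B m)
qed

section \<open>Tent spaces as spaces with weighted square integrals over tents\<close>

abbreviation ball_tent_measure :: "'a::euclidean_space \<Rightarrow> real \<Rightarrow> ('a \<times> real) measure" where
  "ball_tent_measure x r \<equiv> density_on tent_measure (tent (ball x r))"

lemma T_inf_L2:
  assumes "f \<in> T_inf \<omega>" "0 < r"
  shows "f \<in> L2 (ball_tent_measure x r)"
  using assms by (auto simp: T_inf_def L2_density_on_iff)

lemma tent_avg_eq: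
  fixes f :: "'a::euclidean_space \<times> real \<Rightarrow> complex"
  assumes "f \<in> borel_measurable tent_measure" "0 < r"
  shows "tent_avg \<omega> f x r = tent_weight DIM('a) \<omega> r * L2_norm (ball_tent_measure x r) f"
  using assms
  by (simp add: tent_avg_def tent_weight_def L2_norm_density_on content_ball Let_def real_sqrt_divide)

text \<open>
  This is \<open>tent_avg\<close> (see \<open>tent_avg_eq_T_avg\<close>) in the form to which the results on \<open>L2\<close> apply.
\<close>
definition T_avg :: "(real \<Rightarrow> real) \<Rightarrow> ('a::euclidean_space \<times> real \<Rightarrow> complex) \<Rightarrow> 'a \<Rightarrow> real \<Rightarrow> real" where
  "T_avg \<omega> f x r = tent_weight DIM('a) \<omega> r * L2_norm (ball_tent_measure x r) f"

lemma tent_avg_eq_T_avg: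
  "f \<in> T_inf \<omega> \<Longrightarrow> 0 < r \<Longrightarrow> tent_avg \<omega> f x r = T_avg \<omega> f x r"
  by (simp add: tent_avg_eq T_avg_def T_inf_def)

lemma T_inf_iff:
  "f \<in> T_inf \<omega> \<longleftrightarrow> (\<forall>x. \<forall>r>0. f \<in> L2 (ball_tent_measure x r)) \<and>
    (\<exists>B. \<forall>x. \<forall>r>0. T_avg \<omega> f x r \<le> B)"
  (is "?L \<longleftrightarrow> ?R")
proof
  assume f: ?L
  then obtain B where "\<forall>x. \<forall>r\<in>{0<..}. tent_avg \<omega> f x r \<le> B"
    by (auto simp: T_inf_def bdd_above_def)
  then show ?R
    using f T_inf_L2[OF f] tent_avg_eq_T_avg[OF f] by (intro conjI exI[of _ B]) auto
next
  assume f: ?R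
  then have m: "f \<in> borel_measurable tent_measure"
    using L2_density_on_iff[OF sets_tent_ball] by (meson zero_less_one)
  from f obtain B where "\<And>x r. 0 < r \<Longrightarrow> T_avg \<omega> f x r \<le> B"
    by blast
  then have "bdd_above ((\<lambda>(x, r). tent_avg \<omega> f x r) ` (UNIV \<times> {0<..}))"
    using m by (intro bdd_aboveI[of _ B]) (auto simp: tent_avg_eq T_avg_def)
  then show ?L
    using f m by (auto simp: T_inf_def L2_density_on_iff)
qed

lemma T_avg_le_norm:
  assumes f: "f \<in> T_inf \<omega>" and r: "0 < r"
  shows "T_avg \<omega> f x r \<le> T_inf_norm \<omega> f"
proof -
  have "(\<lambda>(x, r). tent_avg \<omega> f x r) (x, r) \<le> T_inf_norm \<omega> f"
    unfolding T_inf_norm_def using f r by (intro cSUP_upper) (auto simp: T_inf_def)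
  then show ?thesis
    using tent_avg_eq_T_avg[OF f r] by simp
qed

lemma T_inf_norm_least:
  assumes f: "f \<in> T_inf \<omega>" and B: "\<And>x r. 0 < r \<Longrightarrow> T_avg \<omega> f x r \<le> B"
  shows "T_inf_norm \<omega> f \<le> B"
  unfolding T_inf_norm_def using B tent_avg_eq_T_avg[OF f] by (intro cSUP_least) auto

context orlicz_function
begin

lemma T_avg_nonneg: "0 < r \<Longrightarrow> 0 \<le> T_avg \<omega> f x r"
  using tent_weight_pos[of r] by (simp add: T_avg_def less_imp_le)

lemma T_avg_add:
  assumes "f \<in> L2 (ball_tent_measure x r)" "h \<in> L2 (ball_tent_measure x r)" "0 < r"
  shows "T_avg \<omega> (\<lambda>p. f p + h p) x r \<le> T_avg \<omega> f x r + T_avg \<omega> h x r"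
  using mult_left_mono[OF L2_norm_triangle[OF assms(1,2)] less_imp_le[OF tent_weight_pos[OF assms(3)]]]
  by (simp add: T_avg_def distrib_left plus_fun_def)

lemma T_avg_scale: "T_avg \<omega> (\<lambda>p. c * f p) x r = cmod c * T_avg \<omega> f x r"
  by (simp add: T_avg_def L2_norm_scale)

lemma T_inf_norm_nonneg:
  fixes f :: "'a::euclidean_space \<times> real \<Rightarrow> complex"
  assumes "f \<in> T_inf \<omega>"
  shows "0 \<le> T_inf_norm \<omega> f"
  using T_avg_le_norm[OF assms, of 1 0] T_avg_nonneg[of 1 f 0] by simp

lemma T_inf_add:
  assumes f: "f \<in> T_inf \<omega>" and h: "h \<in> T_inf \<omega>"
  shows "(\<lambda>p. f p + h p) \<in> T_inf \<omega>" (is ?A)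
    and "T_inf_norm \<omega> (\<lambda>p. f p + h p) \<le> T_inf_norm \<omega> f + T_inf_norm \<omega> h" (is ?B)
proof -
  have le: "T_avg \<omega> (\<lambda>p. f p + h p) x r \<le> T_inf_norm \<omega> f + T_inf_norm \<omega> h" if "0 < r" for x r
    using T_avg_add[OF T_inf_L2[OF f that] T_inf_L2[OF h that] that, of x]
      T_avg_le_norm[OF f that, of x] T_avg_le_norm[OF h that, of x] by simp
  then show A: ?A
    using f h by (auto simp: T_inf_iff intro: L2_add)
  show ?B
    using le by (rule T_inf_norm_least[OF A])
qed

lemma T_inf_scale:
  fixes f :: "'a::euclidean_space \<times> real \<Rightarrow> complex"
  assumes f: "f \<in> T_inf \<omega>"
  shows "(\<lambda>p. c * f p) \<in> T_inf \<omega>" (is ?A)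
    and "T_inf_norm \<omega> (\<lambda>p. c * f p) = cmod c * T_inf_norm \<omega> f" (is ?B)
proof -
  have A: "(\<lambda>p. c * f p) \<in> T_inf \<omega>" and le: "T_inf_norm \<omega> (\<lambda>p. c * f p) \<le> cmod c * T_inf_norm \<omega> f"
    if f: "f \<in> T_inf \<omega>" for c and f :: "'a \<times> real \<Rightarrow> complex"
  proof -
    have le: "T_avg \<omega> (\<lambda>p. c * f p) x r \<le> cmod c * T_inf_norm \<omega> f" if "0 < r" for x r
      unfolding T_avg_scale by (intro mult_left_mono T_avg_le_norm f that) auto
    then show A: "(\<lambda>p. c * f p) \<in> T_inf \<omega>"
      using f by (auto simp: T_inf_iff intro: L2_scale)
    show "T_inf_norm \<omega> (\<lambda>p. c * f p) \<le> cmod c * T_inf_norm \<omega> f"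
      using le by (rule T_inf_norm_least[OF A])
  qed
  show ?A
    using f by (rule A)
  show ?B
  proof (cases "c = 0")
    case True
    then show ?thesis
      using le[OF f, of 0] T_inf_norm_nonneg[OF A[OF f, of 0]] by simp
  next
    case False
    then have "T_inf_norm \<omega> f \<le> cmod (1 / c) * T_inf_norm \<omega> (\<lambda>p. c * f p)"
      using le[OF A[OF f, of c], of "1 / c"] by simp
    then show ?thesis
      using le[OF f, of c] False by (simp add: norm_divide field_simps)
  qed
qed

lemma zero_T_inf: "(\<lambda>p. 0) \<in> T_inf \<omega>"
proof -
  have "(\<lambda>p. 0) \<in> L2 M" "L2_norm M (\<lambda>p. 0) = 0" for M :: "('a \<times> real) measure"
    by (simp_all add: L2_def L2_norm_def)
  then show ?thesis
    by (auto simp: T_inf_iff T_avg_def)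
qed

lemma T_inf_diff:
  assumes f: "f \<in> T_inf \<omega>" and h: "h \<in> T_inf \<omega>"
  shows "(\<lambda>p. f p - h p) \<in> T_inf \<omega>"
  using T_inf_add(1)[OF f T_inf_scale(1)[OF h, of "-1"]] by simp

lemma T_inf_1_iff:
  fixes f :: "'a::euclidean_space \<times> real \<Rightarrow> complex"
  shows "f \<in> T_inf_1 \<omega> \<longleftrightarrow> f \<in> T_inf \<omega> \<and>
    (\<forall>e>0. \<exists>c>0. \<forall>x r. 0 < r \<longrightarrow> r \<le> c \<longrightarrow> T_avg \<omega> f x r \<le> e)"
proof (cases "f \<in> T_inf \<omega>")
  case f: True
  define S where "S c = (SUP (x, r)\<in>(UNIV :: 'a set) \<times> {0<..c}. tent_avg \<omega> f x r)" for c
  have S_le: "S c \<le> e" if "0 < c" "\<And>x r. 0 < r \<Longrightarrow> r \<le> c \<Longrightarrow> T_avg \<omega> f x r \<le> e" for c e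
    unfolding S_def using that tent_avg_eq_T_avg[OF f] by (intro cSUP_least) auto
  have le_S: "T_avg \<omega> f x r \<le> S c" if "0 < r" "r \<le> c" for x r c
  proof -
    have "bdd_above ((\<lambda>(x, r). tent_avg \<omega> f x r) ` ((UNIV :: 'a set) \<times> {0<..c}))"
      by (rule bdd_above_mono[of "(\<lambda>(x, r). tent_avg \<omega> f x r) ` (UNIV \<times> {0<..})"])
        (use f in \<open>auto simp: T_inf_def\<close>)
    then have "(\<lambda>(x, r). tent_avg \<omega> f x r) (x, r) \<le> S c"
      unfolding S_def using that by (intro cSUP_upper) auto
    then show ?thesis
      using tent_avg_eq_T_avg[OF f that(1)] by simp
  qed
  have "(S \<longlongrightarrow> 0) (at_right 0) \<longleftrightarrow>
    (\<forall>e>0. \<exists>c>0. \<forall>x r. 0 < r \<longrightarrow> r \<le> c \<longrightarrow> T_avg \<omega> f x r \<le> e)"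
  proof safe
    fix e :: real
    assume "(S \<longlongrightarrow> 0) (at_right 0)" "0 < e"
    then have "\<forall>\<^sub>F c in at_right 0. S c < e"
      by (intro order_tendstoD)
    then obtain b where b: "0 < b" "\<And>y. 0 < y \<Longrightarrow> y < b \<Longrightarrow> S y < e"
      by (auto simp: eventually_at_right_field)
    show "\<exists>c>0. \<forall>x r. 0 < r \<longrightarrow> r \<le> c \<longrightarrow> T_avg \<omega> f x r \<le> e"
    proof (intro exI[of _ "b / 2"] conjI allI impI)
      show "T_avg \<omega> f x r \<le> e" if "0 < r" "r \<le> b / 2" for x r
        using le_S[OF that, of x] b(2)[of "b / 2"] b(1) by simp
    qed (use b(1) in simp)
  next
    assume *: "\<forall>e>0. \<exists>c>0. \<forall>x r. 0 < r \<longrightarrow> r \<le> c \<longrightarrow> T_avg \<omega> f x r \<le> e"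
    show "(S \<longlongrightarrow> 0) (at_right 0)"
    proof (rule tendstoI)
      fix e :: real
      assume e: "0 < e"
      then obtain c where c: "0 < c" "\<And>x r. 0 < r \<Longrightarrow> r \<le> c \<Longrightarrow> T_avg \<omega> f x r \<le> e / 2"
        using *[rule_format, of "e / 2"] by auto
      have "dist (S y) 0 < e" if y: "0 < y" "y < c" for y
      proof -
        have "S y \<le> e / 2"
          using y c by (intro S_le) auto
        moreover have "0 \<le> S y"
          using le_S[of y y 0] T_avg_nonneg[of y f 0] y by simp
        ultimately show ?thesis
          using e by simp
      qed
      then show "\<forall>\<^sub>F y in at_right 0. dist (S y) 0 < e"
        using c(1) by (auto simp: eventually_at_right_field)
    qed
  qed
  then show ?thesis
    using f by (simp add: T_inf_1_def S_def[abs_def])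
qed (simp add: T_inf_1_def)

lemma T_inf_1D:
  assumes "f \<in> T_inf_1 \<omega>" "0 < e"
  obtains c where "0 < c" "\<And>x r. 0 < r \<Longrightarrow> r \<le> c \<Longrightarrow> T_avg \<omega> f x r \<le> e"
  using assms unfolding T_inf_1_iff by blast

lemma T_inf_1_add:
  assumes f: "f \<in> T_inf_1 \<omega>" and h: "h \<in> T_inf_1 \<omega>"
  shows "(\<lambda>p. f p + h p) \<in> T_inf_1 \<omega>"
  unfolding T_inf_1_iff
proof (intro conjI allI impI)
  have fh: "f \<in> T_inf \<omega>" "h \<in> T_inf \<omega>"
    using f h by (auto simp: T_inf_1_def)
  then show "(\<lambda>p. f p + h p) \<in> T_inf \<omega>"
    by (rule T_inf_add)
  fix e :: real
  assume "0 < e"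
  then have e2: "0 < e / 2"
    by simp
  obtain c where c: "0 < c" "\<And>x r. 0 < r \<Longrightarrow> r \<le> c \<Longrightarrow> T_avg \<omega> f x r \<le> e / 2"
    using T_inf_1D[OF f e2] by blast
  obtain d where d: "0 < d" "\<And>x r. 0 < r \<Longrightarrow> r \<le> d \<Longrightarrow> T_avg \<omega> h x r \<le> e / 2"
    using T_inf_1D[OF h e2] by blast
  show "\<exists>c>0. \<forall>x r. 0 < r \<longrightarrow> r \<le> c \<longrightarrow> T_avg \<omega> (\<lambda>p. f p + h p) x r \<le> e"
  proof (intro exI[of _ "min c d"] conjI allI impI)
    show "T_avg \<omega> (\<lambda>p. f p + h p) x r \<le> e" if "0 < r" "r \<le> min c d" for x r
      using T_avg_add[OF T_inf_L2[OF fh(1)] T_inf_L2[OF fh(2)], of r x] c(2)[of r x] d(2)[of r x] that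
      by simp
  qed (use c d in auto)
qed

lemma T_inf_1_scale:
  assumes f: "f \<in> T_inf_1 \<omega>"
  shows "(\<lambda>p. c * f p) \<in> T_inf_1 \<omega>"
  unfolding T_inf_1_iff
proof (intro conjI allI impI)
  show "(\<lambda>p. c * f p) \<in> T_inf \<omega>"
    using f by (intro T_inf_scale) (simp add: T_inf_1_def)
  fix e :: real
  assume e: "0 < e"
  define e' where "e' = e / (cmod c + 1)"
  have e': "0 < e'" "cmod c * e' \<le> e"
    using e by (auto simp: e'_def field_simps add_pos_nonneg)
  obtain d where d: "0 < d" "\<And>x r. 0 < r \<Longrightarrow> r \<le> d \<Longrightarrow> T_avg \<omega> f x r \<le> e'"
    using T_inf_1D[OF f e'(1)] by blast
  show "\<exists>d>0. \<forall>x r. 0 < r \<longrightarrow> r \<le> d \<longrightarrow> T_avg \<omega> (\<lambda>p. c * f p) x r \<le> e"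
  proof (intro exI[of _ d] conjI allI impI)
    show "T_avg \<omega> (\<lambda>p. c * f p) x r \<le> e" if "0 < r" "r \<le> d" for x r
      using mult_left_mono[OF d(2)[OF that], of "cmod c" x] e'(2) by (simp add: T_avg_scale)
  qed (rule d)
qed

lemma T_inf_c_add:
  assumes f: "f \<in> T_inf_c \<omega>" and h: "h \<in> T_inf_c \<omega>"
  shows "(\<lambda>p. f p + h p) \<in> T_inf_c \<omega>"
proof -
  obtain K K' where K: "compact K" "K \<subseteq> half_space" "AE p in tent_measure. p \<notin> K \<longrightarrow> f p = 0"
    and K': "compact K'" "K' \<subseteq> half_space" "AE p in tent_measure. p \<notin> K' \<longrightarrow> h p = 0"
    using f h by (auto simp: T_inf_c_def)
  have "AE p in tent_measure. p \<notin> K \<union> K' \<longrightarrow> f p + h p = 0"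
    using K(3) K'(3) by eventually_elim auto
  then show ?thesis
    using f h K K' compact_Un[OF K(1) K'(1)] T_inf_add(1)[of f h]
    unfolding T_inf_c_def by blast
qed

lemma T_inf_c_scale:
  assumes f: "f \<in> T_inf_c \<omega>"
  shows "(\<lambda>p. c * f p) \<in> T_inf_c \<omega>"
proof -
  obtain K where K: "compact K" "K \<subseteq> half_space" "AE p in tent_measure. p \<notin> K \<longrightarrow> f p = 0"
    using f by (auto simp: T_inf_c_def)
  have "AE p in tent_measure. p \<notin> K \<longrightarrow> c * f p = 0"
    using K(3) by eventually_elim auto
  then show ?thesis
    using f K T_inf_scale(1)[of f c] unfolding T_inf_c_def by blast
qed

lemma T_inf_v_T_inf: "f \<in> T_inf_v \<omega> \<Longrightarrow> f \<in> T_inf \<omega>"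
  by (simp add: T_inf_v_def T_inf_1_def)

lemma zero_T_inf_v: "(\<lambda>p::'a::euclidean_space \<times> real. 0) \<in> T_inf_v \<omega>"
proof -
  let ?z = "\<lambda>p::'a \<times> real. 0::complex"
  have 0: "T_avg \<omega> ?z x r = 0" for x r
    by (simp add: T_avg_def L2_norm_def)
  have "?z \<in> T_inf_1 \<omega>"
    unfolding T_inf_1_iff using zero_T_inf by (auto simp: 0 intro: exI[of _ 1])
  moreover have "?z \<in> T_inf_c \<omega>"
    using zero_T_inf by (auto simp: T_inf_c_def)
  moreover have "T_inf_norm \<omega> ?z \<le> 0"
    using zero_T_inf by (rule T_inf_norm_least) (simp add: 0)
  ultimately show ?thesis
    unfolding T_inf_v_def by force
qed

lemma T_inf_v_approx:
  assumes "f \<in> T_inf_v \<omega>" "0 < e"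
  obtains h where "h \<in> T_inf_c \<omega>" "h \<in> T_inf \<omega>" "T_inf_norm \<omega> (\<lambda>p. f p - h p) < e"
  using assms unfolding T_inf_v_def T_inf_c_def by blast

lemma T_inf_v_add:
  assumes f: "f \<in> T_inf_v \<omega>" and h: "h \<in> T_inf_v \<omega>"
  shows "(\<lambda>p. f p + h p) \<in> T_inf_v \<omega>"
  unfolding T_inf_v_def
proof (intro CollectI conjI allI impI)
  show "(\<lambda>p. f p + h p) \<in> T_inf_1 \<omega>"
    using f h by (intro T_inf_1_add) (auto simp: T_inf_v_def)
  fix e :: real
  assume "0 < e"
  then have e2: "0 < e / 2"
    by simp
  obtain f' where f': "f' \<in> T_inf_c \<omega>" "T_inf_norm \<omega> (\<lambda>p. f p - f' p) < e / 2" and T1: "f' \<in> T_inf \<omega>"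
    using T_inf_v_approx[OF f e2] .
  obtain h' where h': "h' \<in> T_inf_c \<omega>" "T_inf_norm \<omega> (\<lambda>p. h p - h' p) < e / 2" and T2: "h' \<in> T_inf \<omega>"
    using T_inf_v_approx[OF h e2] .
  have "T_inf_norm \<omega> (\<lambda>p. (f p - f' p) + (h p - h' p)) < e"
    using T_inf_add(2)[OF T_inf_diff[OF T_inf_v_T_inf[OF f] T1] T_inf_diff[OF T_inf_v_T_inf[OF h] T2]] f' h'
    by simp
  then show "\<exists>k\<in>T_inf_c \<omega>. T_inf_norm \<omega> (\<lambda>p. f p + h p - k p) < e"
    using T_inf_c_add[OF f'(1) h'(1)] by (intro bexI[of _ "\<lambda>p. f' p + h' p"]) (simp_all add: algebra_simps)
qed

lemma T_inf_v_scale: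
  assumes f: "f \<in> T_inf_v \<omega>"
  shows "(\<lambda>p. c * f p) \<in> T_inf_v \<omega>"
  unfolding T_inf_v_def
proof (intro CollectI conjI allI impI)
  show "(\<lambda>p. c * f p) \<in> T_inf_1 \<omega>"
    using f by (intro T_inf_1_scale) (auto simp: T_inf_v_def)
  fix e :: real
  assume e: "0 < e"
  define e' where "e' = e / (cmod c + 1)"
  have e': "0 < e'" "cmod c * e' < e"
    using e by (auto simp: e'_def field_simps add_pos_nonneg)
  obtain f' where f': "f' \<in> T_inf_c \<omega>" "T_inf_norm \<omega> (\<lambda>p. f p - f' p) < e'" and T: "f' \<in> T_inf \<omega>"
    using T_inf_v_approx[OF f e'(1)] .
  have "T_inf_norm \<omega> (\<lambda>p. c * (f p - f' p)) = cmod c * T_inf_norm \<omega> (\<lambda>p. f p - f' p)"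
    by (intro T_inf_scale T_inf_diff T_inf_v_T_inf f T)
  also have "\<dots> \<le> cmod c * e'"
    using f'(2) by (intro mult_left_mono) auto
  finally show "\<exists>k\<in>T_inf_c \<omega>. T_inf_norm \<omega> (\<lambda>p. c * f p - k p) < e"
    using T_inf_c_scale[OF f'(1), of c] e'(2)
    by (intro bexI[of _ "\<lambda>p. c * f' p"]) (simp_all add: algebra_simps)
qed

lemma T_inf_c_support:
  fixes h :: "'a::euclidean_space \<times> real \<Rightarrow> complex"
  assumes "h \<in> T_inf_c \<omega>"
  obtains R where "1 \<le> R" "AE p in tent_measure. h p \<noteq> 0 \<longrightarrow> norm (fst p) \<le> R \<and> 1 / R \<le> snd p \<and> snd p \<le> R"
proof -
  obtain K :: "('a \<times> real) set" where K: "compact K" "K \<subseteq> half_space" "AE p in tent_measure. p \<notin> K \<longrightarrow> h p = 0"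
    using assms by (auto simp: T_inf_c_def)
  show thesis
  proof (cases "K = {}")
    case True
    have "AE p in tent_measure. h p \<noteq> 0 \<longrightarrow> norm (fst p) \<le> 1 \<and> 1 / 1 \<le> snd p \<and> snd p \<le> 1"
      using K(3) by eventually_elim (auto simp: True)
    then show ?thesis
      using that[of 1] by auto
  next
    case False
    obtain B where B: "\<And>p. p \<in> K \<Longrightarrow> norm p \<le> B"
      using compact_imp_bounded[OF K(1)] by (auto simp: bounded_iff)
    have "continuous_on K snd"
      by (intro continuous_intros)
    then obtain q where q: "q \<in> K" "\<And>p. p \<in> K \<Longrightarrow> snd q \<le> snd p"
      using continuous_attains_inf[OF K(1) False] by metis
    have q0: "0 < snd q"
      using q(1) K(2) by (auto simp: half_space_def)
    define R where "R = max 1 (max B (1 / snd q))"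
    have R: "1 \<le> R" "B \<le> R" "1 / snd q \<le> R"
      by (auto simp: R_def)
    then have Rq: "1 / R \<le> snd q"
      using q0 by (simp add: field_simps)
    have "norm (fst p) \<le> R \<and> 1 / R \<le> snd p \<and> snd p \<le> R" if "p \<in> K" for p
      using B[OF that] q(2)[OF that] R(2) Rq norm_fst_le[of "fst p" "snd p"] norm_snd_le[of "snd p" "fst p"]
      by simp
    then have "AE p in tent_measure. h p \<noteq> 0 \<longrightarrow> norm (fst p) \<le> R \<and> 1 / R \<le> snd p \<and> snd p \<le> R"
      using K(3) by (auto elim!: eventually_mono)
    then show ?thesis
      using that R(1) by blast
  qed
qed

text \<open>
  The function is supported in the points \<open>(y, t)\<close> with \<open>\<bar>y\<bar> \<le> R\<close> and \<open>1 / R \<le> t \<le> R\<close>, which is part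
  of the tent over the ball of radius \<open>2 R\<close> about 0; so all its norms over tents are at most a constant
  \<open>A\<close>. Large balls contribute little because their weight is small. A ball whose tent meets the support
  has radius at least \<open>1 / R\<close> and, unless it is large, a centre in a bounded set.
\<close>
lemma T_inf_c_tendsto_0:
  fixes h :: "'a::euclidean_space \<times> real \<Rightarrow> complex"
  assumes h: "h \<in> T_inf_c \<omega>" and r: "\<And>j. 0 < r j"
    and fin: "\<And>R. finite {j. 1 / R \<le> r j \<and> r j \<le> R \<and> norm (c j) \<le> R}"
  shows "(\<lambda>j. T_avg \<omega> h (c j) (r j)) \<longlonglongrightarrow> 0"
proof -
  have hT: "h \<in> T_inf \<omega>"
    using h by (simp add: T_inf_c_def)
  obtain R where R: "1 \<le> R"
    and supp: "AE p in tent_measure. h p \<noteq> 0 \<longrightarrow> norm (fst p) \<le> R \<and> 1 / R \<le> snd p \<and> snd p \<le> R"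
    using T_inf_c_support[OF h] .
  define A where "A = L2_norm (ball_tent_measure (0::'a) (2 * R)) h"
  have A0: "0 \<le> A"
    by (simp add: A_def)
  have hA: "L2_norm (ball_tent_measure x s) h \<le> A" if "0 < s" for x s
    unfolding A_def
  proof (rule L2_norm_density_on_mono)
    show "AE p in tent_measure. p \<in> tent (ball x s) \<longrightarrow> p \<notin> tent (ball 0 (2 * R)) \<longrightarrow> h p = 0"
      using supp
    proof eventually_elim
      case (elim p)
      then show ?case
        by (cases p) (auto simp: mem_tent_ball_iff)
    qed
  qed (use R that in \<open>auto intro!: T_inf_L2[OF hT]\<close>)
  show ?thesis
  proof (rule tendstoI)
    fix e :: real
    assume e: "0 < e"
    have "0 < DIM('a)"
      by simp
    from tendstoD[OF tent_weight_tendsto_0[OF this], of "e / (A + 1)"]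
    obtain R' where R': "\<And>s. R' \<le> s \<Longrightarrow> \<bar>tent_weight DIM('a) \<omega> s\<bar> < e / (A + 1)"
      using e A0 by (auto simp: eventually_at_top_linorder dist_real_def)
    define S where "S = max R' R + R"
    have bad: "1 / S \<le> r j \<and> r j \<le> S \<and> norm (c j) \<le> S" if j: "\<not> dist (T_avg \<omega> h (c j) (r j)) 0 < e" for j
    proof -
      have ge: "e \<le> T_avg \<omega> h (c j) (r j)"
        using j T_avg_nonneg[OF r, of h "c j" j] by simp
      have "r j < R'"
      proof (rule ccontr)
        assume "\<not> r j < R'"
        then have w: "tent_weight DIM('a) \<omega> (r j) < e / (A + 1)"
          using R'[of "r j"] by simp
        have "T_avg \<omega> h (c j) (r j) \<le> tent_weight DIM('a) \<omega> (r j) * A"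
          unfolding T_avg_def using hA[OF r] tent_weight_pos[OF r] by (intro mult_left_mono) (auto simp: less_imp_le)
        also have "\<dots> \<le> e / (A + 1) * A"
          using w A0 by (intro mult_right_mono) auto
        also have "\<dots> < e"
          using e A0 by (simp add: field_simps)
        finally show False
          using ge by simp
      qed
      moreover have "1 / R \<le> r j \<and> norm (c j) \<le> R + r j"
      proof (rule ccontr)
        assume far: "\<not> (1 / R \<le> r j \<and> norm (c j) \<le> R + r j)"
        have "AE p in tent_measure. p \<in> tent (ball (c j) (r j)) \<longrightarrow> p \<notin> {} \<longrightarrow> h p = 0"
          using supp
        proof eventually_elim
          case (elim p)
          have "1 / R \<le> r j \<and> norm (c j) \<le> R + r j" if p: "p \<in> tent (ball (c j) (r j))" "h p \<noteq> 0"
          proof -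
            have "norm (c j - fst p) + snd p \<le> r j" "0 < snd p"
              using p(1) by (cases p, simp add: mem_tent_ball_iff dist_norm)+
            then show ?thesis
              using elim p(2) norm_triangle_sub[of "c j" "fst p"] norm_ge_zero[of "c j - fst p"]
              by (intro conjI) linarith+
          qed
          then show ?case
            using far by blast
        qed
        moreover have "h \<in> L2 (density_on tent_measure {})"
          using T_inf_L2[OF hT r] by (auto simp: L2_density_on_iff set_integrable_def)
        ultimately have "L2_norm (ball_tent_measure (c j) (r j)) h \<le> L2_norm (density_on tent_measure {}) h"
          by (intro L2_norm_density_on_mono) (auto intro!: T_inf_L2[OF hT r])
        also have "L2_norm (density_on tent_measure {}) h = 0"
          using hT by (subst L2_norm_density_on) (auto simp: T_inf_def set_lebesgue_integral_def)
        finally have "T_avg \<omega> h (c j) (r j) \<le> 0"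
          using tent_weight_pos[OF r, of "DIM('a)" j] by (simp add: T_avg_def mult_le_0_iff)
        then show False
          using ge e by simp
      qed
      moreover have "1 / S \<le> 1 / R"
        using R by (intro divide_left_mono) (auto simp: S_def)
      ultimately show ?thesis
        using R by (auto simp: S_def max_def)
    qed
    have "finite {j. \<not> dist (T_avg \<omega> h (c j) (r j)) 0 < e}"
      by (rule finite_subset[OF _ fin[of S]]) (use bad in blast)
    then show "\<forall>\<^sub>F j in sequentially. dist (T_avg \<omega> h (c j) (r j)) 0 < e"
      by (simp add: eventually_cofinite flip: cofinite_eq_sequentially)
  qed
qed

lemma T_inf_v_tendsto_0:
  fixes f :: "'a::euclidean_space \<times> real \<Rightarrow> complex"
  assumes f: "f \<in> T_inf_v \<omega>" and r: "\<And>j. 0 < r j"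
    and fin: "\<And>R. finite {j. 1 / R \<le> r j \<and> r j \<le> R \<and> norm (c j) \<le> R}"
  shows "(\<lambda>j. T_avg \<omega> f (c j) (r j)) \<longlonglongrightarrow> 0"
proof (rule tendstoI)
  fix e :: real
  assume "0 < e"
  then have e2: "0 < e / 2"
    by simp
  obtain h where h: "h \<in> T_inf_c \<omega>" "T_inf_norm \<omega> (\<lambda>p. f p - h p) < e / 2" and hT: "h \<in> T_inf \<omega>"
    using T_inf_v_approx[OF f e2] .
  have T: "f \<in> T_inf \<omega>" "h \<in> T_inf \<omega>" "(\<lambda>p. f p - h p) \<in> T_inf \<omega>"
    using T_inf_v_T_inf[OF f] hT T_inf_diff by auto
  have "\<forall>\<^sub>F j in sequentially. dist (T_avg \<omega> h (c j) (r j)) 0 < e / 2"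
    using \<open>0 < e\<close> by (intro tendstoD[OF T_inf_c_tendsto_0[OF h(1) r fin]]) auto
  then show "\<forall>\<^sub>F j in sequentially. dist (T_avg \<omega> f (c j) (r j)) 0 < e"
  proof eventually_elim
    case (elim j)
    have "T_avg \<omega> f (c j) (r j) \<le> T_avg \<omega> (\<lambda>p. f p - h p) (c j) (r j) + T_avg \<omega> h (c j) (r j)"
      using T_avg_add[OF T_inf_L2[OF T(3) r] T_inf_L2[OF T(2) r] r, of "c j" j] by simp
    then show ?case
      using T_avg_le_norm[OF T(3) r, of "c j" j] h(2) elim T_avg_nonneg[OF r, of f "c j" j] by simp
  qed
qed

text \<open>
  A ball lies in a ball of the net of comparable radius; its tent lies in the larger tent and the
  weights are comparable by doubling.
\<close>
lemma T_inf_norm_le_net: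
  fixes c :: "nat \<Rightarrow> 'a::euclidean_space"
  assumes K: "1 \<le> K" and r: "\<And>j. 0 < r j"
    and net: "\<And>x s. 0 < s \<Longrightarrow> \<exists>j. dist x (c j) + s \<le> r j \<and> r j \<le> K * s"
  obtains C where "0 < C"
    and "\<And>f B. f \<in> T_inf \<omega> \<Longrightarrow> (\<And>j. T_avg \<omega> f (c j) (r j) \<le> B) \<Longrightarrow> T_inf_norm \<omega> f \<le> C * B"
proof -
  obtain C where C: "0 < C"
    "\<And>r s. 0 < r \<Longrightarrow> r \<le> s \<Longrightarrow> s \<le> K * r \<Longrightarrow> tent_weight DIM('a) \<omega> r \<le> C * tent_weight DIM('a) \<omega> s"
    using tent_weight_doubling[OF K] by blast
  show thesis
  proof
    show "0 < C"
      by fact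
    show "T_inf_norm \<omega> f \<le> C * B" if f: "f \<in> T_inf \<omega>" and B: "\<And>j. T_avg \<omega> f (c j) (r j) \<le> B" for f B
    proof (rule T_inf_norm_least[OF f])
      fix x :: 'a and s :: real
      assume s: "0 < s"
      then obtain j where j: "dist x (c j) + s \<le> r j" "r j \<le> K * s"
        using net by blast
      have le: "s \<le> r j"
        using j(1) zero_le_dist[of x "c j"] by linarith
      have "tent (ball x s) \<subseteq> tent (ball (c j) (r j))"
        using j(1) by (intro tent_ball_mono) (simp add: dist_commute)
      then have "L2_norm (ball_tent_measure x s) f \<le> L2_norm (ball_tent_measure (c j) (r j)) f"
        by (intro L2_norm_density_on_mono T_inf_L2[OF f] s r) auto
      then have "T_avg \<omega> f x s \<le> (C * tent_weight DIM('a) \<omega> (r j)) * L2_norm (ball_tent_measure (c j) (r j)) f"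
        unfolding T_avg_def using C s le j(2) tent_weight_pos[OF r, of "DIM('a)" j]
        by (intro mult_mono C(2)) auto
      also have "\<dots> \<le> C * B"
        using mult_left_mono[OF B[of j], of C] C(1) by (simp add: T_avg_def mult.assoc)
      finally show "T_avg \<omega> f x s \<le> C * B" .
    qed
  qed
qed

end

section \<open>Atoms and duality\<close>

lemma fun_dual_add: "l \<in> fun_dual V N \<Longrightarrow> f \<in> V \<Longrightarrow> h \<in> V \<Longrightarrow> l (\<lambda>p. f p + h p) = l f + l h"
  unfolding fun_dual_def by blast

lemma fun_dual_scale: "l \<in> fun_dual V N \<Longrightarrow> f \<in> V \<Longrightarrow> l (\<lambda>p. c * f p) = c * l f"
  unfolding fun_dual_def by blast

text \<open>
  Bounds on \<open>l\<close> are assumed because the supremum that defines the dual norm is meaningful only for a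
  bounded set.
\<close>
lemma fun_dual_norm_bounds:
  assumes "f0 \<in> V" "N f0 \<le> 1" "\<And>f. f \<in> V \<Longrightarrow> N f \<le> 1 \<Longrightarrow> cmod (l f) \<le> B"
  shows "0 \<le> fun_dual_norm V N l" "fun_dual_norm V N l \<le> B"
    and "\<And>f. f \<in> V \<Longrightarrow> N f \<le> 1 \<Longrightarrow> cmod (l f) \<le> fun_dual_norm V N l"
proof -
  have bdd: "bdd_above ((\<lambda>f. cmod (l f)) ` {f \<in> V. N f \<le> 1})"
    using assms(3) by (intro bdd_aboveI2) auto
  show upper: "cmod (l f) \<le> fun_dual_norm V N l" if "f \<in> V" "N f \<le> 1" for f
    unfolding fun_dual_norm_def using that by (intro cSUP_upper bdd) auto
  show "0 \<le> fun_dual_norm V N l"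
    using upper[OF assms(1,2)] norm_ge_zero order_trans by blast
  show "fun_dual_norm V N l \<le> B"
    unfolding fun_dual_norm_def using assms by (intro cSUP_least) auto
qed

text \<open>
  The properties of \<open>T_inf\<close> and \<open>T_inf_v\<close> with their seminorm from which facts about \<open>fun_dual_norm\<close>
  follow.
\<close>
locale fun_seminorm =
  fixes V :: "('b \<Rightarrow> complex) set" and N :: "('b \<Rightarrow> complex) \<Rightarrow> real"
  assumes zero: "(\<lambda>p. 0) \<in> V"
    and add: "\<And>f h. f \<in> V \<Longrightarrow> h \<in> V \<Longrightarrow> (\<lambda>p. f p + h p) \<in> V"
    and scale: "\<And>c f. f \<in> V \<Longrightarrow> (\<lambda>p. c * f p) \<in> V"
    and nonneg: "\<And>f. f \<in> V \<Longrightarrow> 0 \<le> N f"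
    and N_scale: "\<And>c f. f \<in> V \<Longrightarrow> N (\<lambda>p. c * f p) = cmod c * N f"
begin

lemma N_zero: "N (\<lambda>p. 0) = 0"
  using N_scale[OF zero, of 0] by simp

lemma norm_bounds:
  assumes "\<And>f. f \<in> V \<Longrightarrow> cmod (l f) \<le> B * N f" "0 \<le> B"
  shows "0 \<le> fun_dual_norm V N l" "fun_dual_norm V N l \<le> B"
proof -
  have "cmod (l f) \<le> B" if "f \<in> V" "N f \<le> 1" for f
    using assms(1)[OF that(1)] mult_left_mono[OF that(2) assms(2)] by simp
  then show "0 \<le> fun_dual_norm V N l" "fun_dual_norm V N l \<le> B"
    using fun_dual_norm_bounds[OF zero, of N l B] N_zero by auto
qed

lemma dual_bounded:
  assumes "l \<in> fun_dual V N"
  obtains B where "0 \<le> B" "\<And>f. f \<in> V \<Longrightarrow> cmod (l f) \<le> B * N f"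
proof -
  obtain B where B: "\<And>f. f \<in> V \<Longrightarrow> cmod (l f) \<le> B * N f"
    using assms unfolding fun_dual_def by blast
  have "cmod (l f) \<le> \<bar>B\<bar> * N f" if "f \<in> V" for f
    using B[OF that] mult_right_mono[OF abs_ge_self nonneg[OF that], of B] by simp
  then show thesis
    using that[of "\<bar>B\<bar>"] by simp
qed

lemma dual_norm_nonneg:
  assumes "l \<in> fun_dual V N"
  shows "0 \<le> fun_dual_norm V N l"
  using dual_bounded[OF assms] norm_bounds(1) by blast

lemma dual_norm:
  assumes l: "l \<in> fun_dual V N" and f: "f \<in> V"
  shows "cmod (l f) \<le> fun_dual_norm V N l * N f"
proof -
  obtain B where B: "0 \<le> B" "\<And>f. f \<in> V \<Longrightarrow> cmod (l f) \<le> B * N f"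
    using dual_bounded[OF l] by blast
  show ?thesis
  proof (cases "N f = 0")
    case True
    then show ?thesis
      using B(2)[OF f] by simp
  next
    case False
    then have pos: "0 < N f"
      using nonneg[OF f] by simp
    let ?f = "\<lambda>p. complex_of_real (1 / N f) * f p"
    have "cmod (l ?f) \<le> fun_dual_norm V N l"
    proof (rule fun_dual_norm_bounds(3)[OF zero _ _ scale[OF f]])
      show "N (\<lambda>p. 0) \<le> 1"
        by (simp add: N_zero)
      show "cmod (l g) \<le> B" if "g \<in> V" "N g \<le> 1" for g
        using B(2)[OF that(1)] mult_left_mono[OF that(2) B(1)] by simp
      show "N ?f \<le> 1"
        using pos by (simp only: N_scale[OF f] norm_of_real) simp
    qed
    moreover have "l ?f = complex_of_real (1 / N f) * l f"
      using l f by (rule fun_dual_scale)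
    ultimately have "cmod (complex_of_real (1 / N f)) * cmod (l f) \<le> fun_dual_norm V N l"
      by (simp only: norm_mult)
    then show ?thesis
      using pos by (simp add: norm_divide field_simps)
  qed
qed

end

context orlicz_function
begin

lemma fun_seminorm_T_inf: "fun_seminorm (T_inf \<omega> :: ('a::euclidean_space \<times> real \<Rightarrow> complex) set) (T_inf_norm \<omega>)"
  by unfold_locales (auto intro: zero_T_inf T_inf_add T_inf_scale T_inf_norm_nonneg)

lemma fun_seminorm_T_inf_v: "fun_seminorm (T_inf_v \<omega> :: ('a::euclidean_space \<times> real \<Rightarrow> complex) set) (T_inf_norm \<omega>)"
  by unfold_locales (auto intro: zero_T_inf_v T_inf_v_add T_inf_v_scale T_inf_norm_nonneg T_inf_scale T_inf_v_T_inf)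

lemma tent_weight_square:
  fixes x :: "'a::euclidean_space"
  assumes "0 < r"
  shows "(tent_weight DIM('a) \<omega> r)\<^sup>2 = inverse (measure lebesgue (ball x r)) *
    inverse ((orlicz_rho \<omega> (measure lebesgue (ball x r)))\<^sup>2)"
  using assms
  by (simp add: tent_weight_def content_ball Let_def power_divide power_mult_distrib inverse_eq_divide)

text \<open>
  The size condition on an atom says exactly that its norm in \<open>L\<^sup>2\<close> of the tent is at most the weight of
  the ball. By Cauchy-Schwarz the pairing is then at most the weight times the norm of \<open>g\<close> over the tent,
  which is one of the quantities in the supremum defining the norm of \<open>g\<close>.
\<close>
lemma T_atom_pairing:
  fixes a :: "'a::euclidean_space \<times> real \<Rightarrow> complex"
  assumes a: "T_atom \<omega> a" and g: "g \<in> T_inf \<omega>"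
  shows "integrable tent_measure (\<lambda>p. a p * g p)"
    and "cmod (fun_pairing a g) \<le> T_inf_norm \<omega> g"
proof -
  obtain x r where r: "0 < r" and m [measurable]: "a \<in> borel_measurable tent_measure"
    and supp: "AE p in tent_measure. p \<notin> tent (ball x r) \<longrightarrow> a p = 0"
    and int: "set_integrable tent_measure (tent (ball x r)) (\<lambda>p. (cmod (a p))\<^sup>2)"
    and "(LINT p : tent (ball x r) | tent_measure. (cmod (a p))\<^sup>2) \<le> inverse (measure lebesgue (ball x r)) *
      inverse ((orlicz_rho \<omega> (measure lebesgue (ball x r)))\<^sup>2)"
    using a by (auto simp: T_atom_def)
  then have le: "(LINT p : tent (ball x r) | tent_measure. (cmod (a p))\<^sup>2) \<le> (tent_weight DIM('a) \<omega> r)\<^sup>2"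
    by (simp only: tent_weight_square[OF r, of x])
  let ?M = "ball_tent_measure x r"
  have aL: "a \<in> L2 ?M"
    using m int by (simp add: L2_density_on_iff)
  have gL: "g \<in> L2 ?M"
    using g r by (rule T_inf_L2)
  have [measurable]: "g \<in> borel_measurable tent_measure"
    using g by (simp add: T_inf_def)
  have "AE p in tent_measure. p \<notin> tent (ball x r) \<longrightarrow> a p * g p = 0"
    using supp by eventually_elim auto
  note density_on = density_on_integral_eq[OF sets_tent_ball _ this]
  show "integrable tent_measure (\<lambda>p. a p * g p)"
    using L2_mult_integrable[OF aL gL] by (subst (asm) density_on(1)) auto
  have "L2_norm ?M a \<le> sqrt ((tent_weight DIM('a) \<omega> r)\<^sup>2)"
    using le by (simp only: L2_norm_density_on[OF sets_tent_ball m] real_sqrt_le_iff)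
  then have aw: "L2_norm ?M a \<le> tent_weight DIM('a) \<omega> r"
    using tent_weight_pos[OF r, of "DIM('a)"] by simp
  have "fun_pairing a g = (LINT p|?M. a p * g p)"
    unfolding fun_pairing_def by (rule density_on(2)[symmetric]) auto
  also have "cmod \<dots> \<le> L2_norm ?M a * L2_norm ?M g"
    by (rule L2_cauchy_schwarz[OF aL gL])
  also have "\<dots> \<le> T_avg \<omega> g x r"
    unfolding T_avg_def by (rule mult_right_mono[OF aw]) simp
  also have "\<dots> \<le> T_inf_norm \<omega> g"
    by (rule T_avg_le_norm[OF g r])
  finally show "cmod (fun_pairing a g) \<le> T_inf_norm \<omega> g" .
qed

text \<open>
  Scaling a square integrable function on a tent to norm \<open>\<kappa>(r)\<close> makes it an atom, with coefficient
  \<open>\<parallel>h\<parallel> / \<kappa>(r)\<close>; this is where the \<open>\<ell>\<^sup>1\<close>-sum of dual spaces becomes an atomic decomposition.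
\<close>
lemma L2_tent_atom:
  fixes x :: "'a::euclidean_space"
  assumes r: "0 < r" and h: "h \<in> L2 (ball_tent_measure x r)"
  obtains a where "T_atom \<omega> a"
    and "\<And>g. g \<in> T_inf \<omega> \<Longrightarrow>
      complex_of_real (L2_norm (ball_tent_measure x r) h / tent_weight DIM('a) \<omega> r) * fun_pairing a g
        = (LINT p|ball_tent_measure x r. h p * g p)"
proof -
  let ?M = "ball_tent_measure x r" and ?w = "tent_weight DIM('a) \<omega> r"
  have w: "0 < ?w"
    using r by (rule tent_weight_pos)
  have [measurable]: "h \<in> borel_measurable tent_measure"
    using h by (simp add: L2_density_on_iff)
  \<comment> \<open>If \<open>h\<close> vanishes almost everywhere then \<open>s = 0\<close> and the atom is the zero function.\<close>
  define s where "s = complex_of_real (?w / L2_norm ?M h)"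
  define a where "a p = indicator (tent (ball x r)) p *\<^sub>R (s * h p)" for p
  have [measurable]: "a \<in> borel_measurable tent_measure"
    unfolding a_def by measurable
  have shL: "(\<lambda>p. s * h p) \<in> L2 ?M"
    using h by (rule L2_scale)
  have eq: "indicat_real (tent (ball x r)) p * (cmod (a p))\<^sup>2
      = indicat_real (tent (ball x r)) p * (cmod (s * h p))\<^sup>2" for p
    by (simp add: a_def indicator_def)
  have int: "set_integrable tent_measure (tent (ball x r)) (\<lambda>p. (cmod (a p))\<^sup>2)"
    using shL by (simp add: L2_density_on_iff set_integrable_def eq)
  have "L2_norm ?M a = L2_norm ?M (\<lambda>p. s * h p)"
    by (simp add: L2_norm_density_on set_lebesgue_integral_def eq)
  also have "\<dots> = cmod s * L2_norm ?M h"
    by (rule L2_norm_scale)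
  also have "\<dots> \<le> ?w"
    using w by (cases "L2_norm ?M h = 0") (simp_all add: s_def norm_divide)
  finally have "(L2_norm ?M a)\<^sup>2 \<le> ?w\<^sup>2"
    by (intro power_mono) auto
  moreover have "(L2_norm ?M a)\<^sup>2 = (LINT p : tent (ball x r) | tent_measure. (cmod (a p))\<^sup>2)"
    by (simp add: L2_norm_density_on set_lebesgue_integral_def)
  ultimately have "T_atom \<omega> a"
    unfolding T_atom_def using r int tent_weight_square[OF r, of x]
    by (intro conjI exI[of _ x] exI[of _ r]) (auto simp: a_def)
  moreover have "complex_of_real (L2_norm ?M h / ?w) * fun_pairing a g = (LINT p|?M. h p * g p)"
    if g: "g \<in> T_inf \<omega>" for g
  proof -
    have [measurable]: "g \<in> borel_measurable tent_measure"
      using g by (simp add: T_inf_def)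
    have "fun_pairing a g = (LINT p|?M. s * (h p * g p))"
      unfolding fun_pairing_def density_on_def
      by (subst integral_density) (auto simp: a_def mult.assoc)
    then have fp: "fun_pairing a g = s * (LINT p|?M. h p * g p)"
      by simp
    show ?thesis
    proof (cases "L2_norm ?M h = 0")
      case True
      then show ?thesis
        using L2_cauchy_schwarz[OF h T_inf_L2[OF g r]] by simp
    next
      case False
      then show ?thesis
        using w by (simp add: fp s_def)
    qed
  qed
  ultimately show thesis
    using that by blast
qed

lemma fun_pairing_linear:
  assumes "T_atom \<omega> a"
  shows "f \<in> T_inf \<omega> \<Longrightarrow> h \<in> T_inf \<omega> \<Longrightarrow> fun_pairing a (\<lambda>p. f p + h p) = fun_pairing a f + fun_pairing a h"
    and "fun_pairing a (\<lambda>p. c * f p) = c * fun_pairing a f"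
  using T_atom_pairing(1)[OF assms]
  by (simp_all add: fun_pairing_def distrib_left mult.left_commute[of _ c])

text \<open>
  Convergence in the norm of the dual implies convergence at each \<open>g\<close>, because the differences are
  themselves bounded functionals.
\<close>
lemma atomic_decomp_sums:
  fixes g :: "'a::euclidean_space \<times> real \<Rightarrow> complex"
  assumes F: "F \<in> fun_dual (T_inf \<omega>) (T_inf_norm \<omega>)" and dec: "atomic_decomp \<omega> F lam a"
    and g: "g \<in> T_inf \<omega>"
  shows "(\<lambda>j. lam j * fun_pairing (a j) g) sums F g"
    and "cmod (F g) \<le> (\<Sum>j. cmod (lam j)) * T_inf_norm \<omega> g"
proof -
  interpret T: fun_seminorm "T_inf \<omega> :: ('a \<times> real \<Rightarrow> complex) set" "T_inf_norm \<omega>"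
    by (rule fun_seminorm_T_inf)
  have atom: "T_atom \<omega> (a j)" and sum: "summable (\<lambda>j. cmod (lam j))"
    and lim: "(\<lambda>N. fun_dual_norm (T_inf \<omega>) (T_inf_norm \<omega>)
      (\<lambda>g. F g - (\<Sum>j<N. lam j * fun_pairing (a j) g))) \<longlonglongrightarrow> 0" for j
    using dec by (auto simp: atomic_decomp_def)
  define D where "D N g = F g - (\<Sum>j<N. lam j * fun_pairing (a j) g)" for N :: nat and g
  obtain B where B: "\<And>f. f \<in> T_inf \<omega> \<Longrightarrow> cmod (F f) \<le> B * T_inf_norm \<omega> f"
    using T.dual_bounded[OF F] by blast
  have "D N \<in> fun_dual (T_inf \<omega>) (T_inf_norm \<omega>)" for N
    unfolding fun_dual_def
  proof (intro CollectI conjI ballI allI)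
    show "D N (\<lambda>p. f p + h p) = D N f + D N h" if "f \<in> T_inf \<omega>" "h \<in> T_inf \<omega>" for f h
      using F that fun_pairing_linear(1)[OF atom that]
      by (simp add: D_def fun_dual_def distrib_left sum.distrib)
    show "D N (\<lambda>p. c * f p) = c * D N f" if "f \<in> T_inf \<omega>" for c f
      using F that fun_pairing_linear(2)[OF atom]
      by (simp add: D_def fun_dual_def right_diff_distrib sum_distrib_left mult.left_commute)
    show "\<exists>C. \<forall>f\<in>T_inf \<omega>. cmod (D N f) \<le> C * T_inf_norm \<omega> f"
    proof (intro exI ballI)
      fix f :: "'a \<times> real \<Rightarrow> complex"
      assume f: "f \<in> T_inf \<omega>"
      have "cmod (D N f) \<le> cmod (F f) + (\<Sum>j<N. cmod (lam j * fun_pairing (a j) f))"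
        unfolding D_def by (intro order_trans[OF norm_triangle_ineq4] add_left_mono norm_sum)
      also have "\<dots> \<le> B * T_inf_norm \<omega> f + (\<Sum>j<N. cmod (lam j) * T_inf_norm \<omega> f)"
        unfolding norm_mult by (intro add_mono B f sum_mono mult_left_mono T_atom_pairing(2) atom) auto
      finally show "cmod (D N f) \<le> (B + (\<Sum>j<N. cmod (lam j))) * T_inf_norm \<omega> f"
        by (simp add: distrib_right sum_distrib_right)
    qed
  qed
  then have "cmod (D N g) \<le> fun_dual_norm (T_inf \<omega>) (T_inf_norm \<omega>) (D N) * T_inf_norm \<omega> g" for N
    using T.dual_norm g by blast
  moreover have "(\<lambda>N. fun_dual_norm (T_inf \<omega>) (T_inf_norm \<omega>) (D N) * T_inf_norm \<omega> g) \<longlonglongrightarrow> 0"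
    using lim by (intro tendsto_mult_left_zero) (simp add: D_def[abs_def])
  ultimately have "(\<lambda>N. D N g) \<longlonglongrightarrow> 0"
    by (intro Lim_null_comparison[of "\<lambda>N. D N g"] always_eventually) auto
  then have "(\<lambda>N. F g - D N g) \<longlonglongrightarrow> F g - 0"
    by (intro tendsto_intros)
  then show sums: "(\<lambda>j. lam j * fun_pairing (a j) g) sums F g"
    by (simp add: D_def sums_def)
  have le: "norm (lam j * fun_pairing (a j) g) \<le> cmod (lam j) * T_inf_norm \<omega> g" for j
    unfolding norm_mult by (intro mult_left_mono T_atom_pairing(2) atom g) auto
  have "norm (\<Sum>j. lam j * fun_pairing (a j) g) \<le> (\<Sum>j. cmod (lam j) * T_inf_norm \<omega> g)"
    by (rule norm_suminf_le[OF le]) (rule summable_mult2[OF sum])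
  then show "cmod (F g) \<le> (\<Sum>j. cmod (lam j)) * T_inf_norm \<omega> g"
    using sums_unique[OF sums] suminf_mult2[OF sum, of "T_inf_norm \<omega> g"] by simp
qed

text \<open>
  Every decomposition of \<open>F\<close> sums to the value of \<open>F\<close> at \<open>g\<close>, so the description that defines the
  pairing is unique.
\<close>
lemma T_pairing_eq:
  assumes F: "F \<in> T_tilde \<omega>" and g: "g \<in> T_inf \<omega>"
  shows "T_pairing \<omega> F g = F g"
proof -
  have F': "F \<in> fun_dual (T_inf \<omega>) (T_inf_norm \<omega>)"
    using F by (simp add: T_tilde_def)
  obtain lam a where "atomic_decomp \<omega> F lam a"
    using F by (auto simp: T_tilde_def)
  then show ?thesis
    unfolding T_pairing_def
    using atomic_decomp_sums(1)[OF F' _ g] sums_unique2 by (intro the_equality) blast+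
qed

lemma T_tilde_norm_bound:
  assumes F: "F \<in> T_tilde \<omega>" and g: "g \<in> T_inf \<omega>"
  shows "cmod (F g) \<le> T_tilde_norm \<omega> F * T_inf_norm \<omega> g"
proof (cases "T_inf_norm \<omega> g = 0")
  case True
  then show ?thesis
    using F g atomic_decomp_sums(2)[OF _ _ g] by (fastforce simp: T_tilde_def)
next
  case False
  then have pos: "0 < T_inf_norm \<omega> g"
    using T_inf_norm_nonneg[OF g] by simp
  have "cmod (F g) / T_inf_norm \<omega> g \<le> T_tilde_norm \<omega> F"
    unfolding T_tilde_norm_def
  proof (rule cInf_greatest)
    show "{\<Sum>j. cmod (lam j) |lam. \<exists>a. atomic_decomp \<omega> F lam a} \<noteq> {}"
      using F by (auto simp: T_tilde_def)
    show "cmod (F g) / T_inf_norm \<omega> g \<le> s"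
      if "s \<in> {\<Sum>j. cmod (lam j) |lam. \<exists>a. atomic_decomp \<omega> F lam a}" for s
      using that F pos atomic_decomp_sums(2)[OF _ _ g] by (auto simp: T_tilde_def field_simps)
  qed
  then show ?thesis
    using pos by (simp add: field_simps)
qed

lemma T_tilde_norm_le:
  assumes "atomic_decomp \<omega> F lam a"
  shows "T_tilde_norm \<omega> F \<le> (\<Sum>j. cmod (lam j))"
  unfolding T_tilde_norm_def
proof (rule cInf_lower)
  show "bdd_below {\<Sum>j. cmod (lam j) |lam. \<exists>a. atomic_decomp \<omega> F lam a}"
    by (rule bdd_belowI[of _ 0]) (auto simp: atomic_decomp_def intro: suminf_nonneg)
qed (use assms in blast)

text \<open>
  Conversely, any atoms with absolutely summable coefficients define an element of \<open>T_tilde\<close>: the tail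
  of the series is bounded in the dual norm by the tail of the coefficients.
\<close>
lemma atomic_series:
  fixes a :: "nat \<Rightarrow> 'a::euclidean_space \<times> real \<Rightarrow> complex"
  assumes atom: "\<And>j. T_atom \<omega> (a j)" and sum: "summable (\<lambda>j. cmod (lam j))"
  defines "F \<equiv> \<lambda>g. \<Sum>j. lam j * fun_pairing (a j) g"
  shows "F \<in> T_tilde \<omega>" "T_tilde_norm \<omega> F \<le> (\<Sum>j. cmod (lam j))"
proof -
  interpret T: fun_seminorm "T_inf \<omega> :: ('a \<times> real \<Rightarrow> complex) set" "T_inf_norm \<omega>"
    by (rule fun_seminorm_T_inf)
  let ?t = "\<lambda>g j. lam j * fun_pairing (a j) g"
  have le: "norm (?t g j) \<le> cmod (lam j) * T_inf_norm \<omega> g" if "g \<in> T_inf \<omega>" for g j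
    unfolding norm_mult by (intro mult_left_mono T_atom_pairing(2) atom that) auto
  have sg: "summable (?t g)" if "g \<in> T_inf \<omega>" for g
    by (rule summable_comparison_test'[OF summable_mult2[OF sum] le[OF that]])
  have tail: "cmod (F g - (\<Sum>j<N. ?t g j)) \<le> ((\<Sum>j. cmod (lam j)) - (\<Sum>j<N. cmod (lam j))) * T_inf_norm \<omega> g"
    if g: "g \<in> T_inf \<omega>" for g N
  proof -
    have "F g - (\<Sum>j<N. ?t g j) = (\<Sum>j. ?t g (j + N))"
      unfolding F_def by (simp add: suminf_minus_initial_segment[OF sg[OF g]])
    also have "cmod \<dots> \<le> (\<Sum>j. cmod (lam (j + N)) * T_inf_norm \<omega> g)"
      by (rule norm_suminf_le[OF le[OF g]]) (intro summable_mult2 summable_ignore_initial_segment sum)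
    also have "\<dots> = (\<Sum>j. cmod (lam (j + N))) * T_inf_norm \<omega> g"
      by (rule suminf_mult2[symmetric]) (rule summable_ignore_initial_segment[OF sum])
    finally show ?thesis
      by (simp add: suminf_minus_initial_segment[OF sum])
  qed
  have "F \<in> fun_dual (T_inf \<omega>) (T_inf_norm \<omega>)"
    unfolding fun_dual_def
  proof (intro CollectI conjI ballI allI)
    show "F (\<lambda>p. f p + h p) = F f + F h" if "f \<in> T_inf \<omega>" "h \<in> T_inf \<omega>" for f h
      unfolding F_def by (simp add: fun_pairing_linear(1)[OF atom that] distrib_left suminf_add sg that)
    show "F (\<lambda>p. c * f p) = c * F f" if "f \<in> T_inf \<omega>" for c f
      unfolding F_def
      by (simp add: fun_pairing_linear(2)[OF atom] mult.left_commute[of _ c] suminf_mult sg that)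
    show "\<exists>C. \<forall>f\<in>T_inf \<omega>. cmod (F f) \<le> C * T_inf_norm \<omega> f"
      using tail[of _ 0] by (intro exI[of _ "\<Sum>j. cmod (lam j)"]) simp
  qed
  moreover have dec: "atomic_decomp \<omega> F lam a"
    unfolding atomic_decomp_def
  proof (intro conjI allI atom sum)
    have t0: "0 \<le> (\<Sum>j. cmod (lam j)) - (\<Sum>j<N. cmod (lam j))" for N
      using sum_le_suminf[OF sum, of "{..<N}"] by simp
    have "(\<lambda>N. (\<Sum>j. cmod (lam j)) - (\<Sum>j<N. cmod (lam j))) \<longlonglongrightarrow> (\<Sum>j. cmod (lam j)) - (\<Sum>j. cmod (lam j))"
      by (intro tendsto_intros summable_LIMSEQ sum)
    then have lim: "(\<lambda>N. (\<Sum>j. cmod (lam j)) - (\<Sum>j<N. cmod (lam j))) \<longlonglongrightarrow> 0"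
      by simp
    show "(\<lambda>N. fun_dual_norm (T_inf \<omega>) (T_inf_norm \<omega>) (\<lambda>g. F g - (\<Sum>j<N. ?t g j))) \<longlonglongrightarrow> 0"
      by (rule tendsto_sandwich[OF _ _ tendsto_const lim])
        (auto intro!: always_eventually T.norm_bounds tail t0)
  qed
  ultimately show "F \<in> T_tilde \<omega>"
    by (auto simp: T_tilde_def)
  show "T_tilde_norm \<omega> F \<le> (\<Sum>j. cmod (lam j))"
    by (rule T_tilde_norm_le[OF dec])
qed

theorem T_tilde_subset_dual:
  assumes F: "F \<in> T_tilde \<omega>"
  shows "(\<lambda>f. T_pairing \<omega> F f) \<in> fun_dual (T_inf_v \<omega> :: ('a::euclidean_space \<times> real \<Rightarrow> complex) set) (T_inf_norm \<omega>)"
    and "fun_dual_norm (T_inf_v \<omega> :: ('a \<times> real \<Rightarrow> complex) set) (T_inf_norm \<omega>) (\<lambda>f. T_pairing \<omega> F f)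
      \<le> T_tilde_norm \<omega> F"
proof -
  interpret V: fun_seminorm "T_inf_v \<omega> :: ('a \<times> real \<Rightarrow> complex) set" "T_inf_norm \<omega>"
    by (rule fun_seminorm_T_inf_v)
  have F': "F \<in> fun_dual (T_inf \<omega>) (T_inf_norm \<omega>)"
    using F by (simp add: T_tilde_def)
  have eq: "T_pairing \<omega> F f = F f" if "f \<in> T_inf_v \<omega>" for f
    using F T_inf_v_T_inf[OF that] by (rule T_pairing_eq)
  have le: "cmod (T_pairing \<omega> F f) \<le> T_tilde_norm \<omega> F * T_inf_norm \<omega> f" if "f \<in> T_inf_v \<omega>" for f
    unfolding eq[OF that] using F T_inf_v_T_inf[OF that] by (rule T_tilde_norm_bound)
  show "(\<lambda>f. T_pairing \<omega> F f) \<in> fun_dual (T_inf_v \<omega>) (T_inf_norm \<omega>)"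
    unfolding fun_dual_def
  proof (intro CollectI conjI ballI allI)
    show "T_pairing \<omega> F (\<lambda>p. f p + h p) = T_pairing \<omega> F f + T_pairing \<omega> F h"
      if "f \<in> T_inf_v \<omega>" "h \<in> T_inf_v \<omega>" for f h
      using fun_dual_add[OF F' T_inf_v_T_inf T_inf_v_T_inf] that by (simp add: eq T_inf_v_add)
    show "T_pairing \<omega> F (\<lambda>p. c * f p) = c * T_pairing \<omega> F f" if "f \<in> T_inf_v \<omega>" for c f
      using fun_dual_scale[OF F' T_inf_v_T_inf] that by (simp add: eq T_inf_v_scale)
    show "\<exists>C. \<forall>f\<in>T_inf_v \<omega>. cmod (T_pairing \<omega> F f) \<le> C * T_inf_norm \<omega> f"
      using le by blast
  qed
  have "0 \<le> T_tilde_norm \<omega> F"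
    unfolding T_tilde_norm_def using F
    by (intro cInf_greatest) (auto simp: T_tilde_def atomic_decomp_def intro: suminf_nonneg)
  with le show "fun_dual_norm (T_inf_v \<omega>) (T_inf_norm \<omega>) (\<lambda>f. T_pairing \<omega> F f) \<le> T_tilde_norm \<omega> F"
    by (rule V.norm_bounds(2))
qed

text \<open>
  The functions \<open>h\<^sub>j\<close> that represent \<open>l\<close> on the \<open>c\<^sub>0\<close>-sum over the net live on the tents of the net; their
  normalisations are the atoms. The constant is the one that compares the supremum over the net with the
  supremum over all balls.
\<close>
theorem dual_subset_T_tilde:
  obtains C where "0 < C"
    and "\<And>l. l \<in> fun_dual (T_inf_v \<omega> :: ('a::euclidean_space \<times> real \<Rightarrow> complex) set) (T_inf_norm \<omega>) \<Longrightarrow>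
      \<exists>F\<in>T_tilde \<omega>. (\<forall>f\<in>T_inf_v \<omega>. l f = T_pairing \<omega> F f) \<and>
        T_tilde_norm \<omega> F \<le> C * fun_dual_norm (T_inf_v \<omega>) (T_inf_norm \<omega>) l"
proof -
  interpret V: fun_seminorm "T_inf_v \<omega> :: ('a \<times> real \<Rightarrow> complex) set" "T_inf_norm \<omega>"
    by (rule fun_seminorm_T_inf_v)
  obtain c :: "nat \<Rightarrow> 'a" and r :: "nat \<Rightarrow> real" and K
    where r: "\<And>j. 0 < r j" and K: "1 \<le> K"
      and net: "\<And>x s. 0 < s \<Longrightarrow> \<exists>j. dist x (c j) + s \<le> r j \<and> r j \<le> K * s"
      and fin: "\<And>R. finite {j. 1 / R \<le> r j \<and> r j \<le> R \<and> norm (c j) \<le> R}"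
    by (rule locally_finite_ball_net) blast+
  obtain C where C: "0 < C"
    and norm_le: "\<And>f B. f \<in> T_inf \<omega> \<Longrightarrow> (\<And>j. T_avg \<omega> f (c j) (r j) \<le> B) \<Longrightarrow> T_inf_norm \<omega> f \<le> C * B"
    using T_inf_norm_le_net[OF K r net] by blast
  define \<mu> where "\<mu> j = ball_tent_measure (c j) (r j)" for j
  define \<kappa> where "\<kappa> j = tent_weight DIM('a) \<omega> (r j)" for j
  have \<kappa>: "0 < \<kappa> j" for j
    unfolding \<kappa>_def by (rule tent_weight_pos[OF r])
  have avg: "T_avg \<omega> f (c j) (r j) = \<kappa> j * L2_norm (\<mu> j) f" for f j
    by (simp add: T_avg_def \<mu>_def \<kappa>_def)
  have c0: "(\<lambda>j. f) \<in> c0_L2 \<mu> \<kappa>" if "f \<in> T_inf_v \<omega>" for f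
    using T_inf_v_tendsto_0[OF that r fin] T_inf_L2[OF T_inf_v_T_inf[OF that] r]
    by (simp add: c0_L2_def avg[symmetric]) (simp add: \<mu>_def)
  show thesis
  proof
    show "0 < C"
      by fact
    fix l
    assume l: "l \<in> fun_dual (T_inf_v \<omega> :: ('a \<times> real \<Rightarrow> complex) set) (T_inf_norm \<omega>)"
    define A where "A = fun_dual_norm (T_inf_v \<omega>) (T_inf_norm \<omega>) l"
    have A: "0 \<le> A"
      unfolding A_def using l by (rule V.dual_norm_nonneg)
    have l_le: "cmod (l f) \<le> (C * A) * c0_L2_norm \<mu> \<kappa> (\<lambda>j. f)" if f: "f \<in> T_inf_v \<omega>" for f
    proof -
      have "T_inf_norm \<omega> f \<le> C * c0_L2_norm \<mu> \<kappa> (\<lambda>j. f)"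
        using c0_L2_norm_upper[OF \<kappa> c0[OF f]] by (intro norm_le T_inf_v_T_inf[OF f]) (simp add: avg)
      then have "A * T_inf_norm \<omega> f \<le> A * (C * c0_L2_norm \<mu> \<kappa> (\<lambda>j. f))"
        using A by (rule mult_left_mono)
      then show ?thesis
        using V.dual_norm[OF l f] by (simp add: A_def mult_ac)
    qed
    have CA: "0 \<le> C * A"
      using C A by simp
    obtain h where h: "\<And>j. h j \<in> L2 (\<mu> j)"
      and hC: "\<And>N. (\<Sum>j<N. L2_norm (\<mu> j) (h j) / \<kappa> j) \<le> C * A"
      and hl: "\<And>f. f \<in> T_inf_v \<omega> \<Longrightarrow> (\<lambda>j. LINT x|\<mu> j. h j x * f x) sums l f"
      by (rule c0_L2_subspace_dual[OF \<kappa> CA V.zero V.add V.scale c0 fun_dual_add[OF l] fun_dual_scale[OF l] l_le])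
        blast+
    define lam where "lam j = L2_norm (\<mu> j) (h j) / \<kappa> j" for j
    have "\<exists>a. T_atom \<omega> a \<and> (\<forall>g\<in>T_inf \<omega>.
        complex_of_real (lam j) * fun_pairing a g = (LINT p|\<mu> j. h j p * g p))" for j
    proof (rule L2_tent_atom[OF r h[of j, unfolded \<mu>_def]])
      fix b
      assume "T_atom \<omega> b" and "\<And>g. g \<in> T_inf \<omega> \<Longrightarrow>
        complex_of_real (L2_norm (ball_tent_measure (c j) (r j)) (h j) / tent_weight DIM('a) \<omega> (r j)) * fun_pairing b g
          = (LINT p|ball_tent_measure (c j) (r j). h j p * g p)"
      then show ?thesis
        unfolding lam_def \<mu>_def \<kappa>_def by blast
    qed
    then obtain a where a: "\<And>j. T_atom \<omega> (a j)"
      and ah: "\<And>j g. g \<in> T_inf \<omega> \<Longrightarrow> complex_of_real (lam j) * fun_pairing (a j) g = (LINT p|\<mu> j. h j p * g p)"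
      by metis
    have lam0: "0 \<le> lam j" for j
      using \<kappa>[of j] by (simp add: lam_def)
    have sum: "summable lam"
      using lam0 hC by (intro summableI_nonneg_bounded[of lam "C * A"]) (auto simp: lam_def)
    have cm: "cmod (complex_of_real (lam j)) = lam j" for j
      using lam0 by simp
    define F where "F g = (\<Sum>j. complex_of_real (lam j) * fun_pairing (a j) g)" for g
    have F: "F \<in> T_tilde \<omega>" "T_tilde_norm \<omega> F \<le> (\<Sum>j. lam j)"
      using atomic_series[of a "\<lambda>j. complex_of_real (lam j)", OF a] sum
      unfolding cm F_def[abs_def] by blast+
    have "(\<Sum>j. lam j) \<le> C * A"
      using hC by (intro suminf_le_const[OF sum]) (simp add: lam_def)
    moreover have "l f = T_pairing \<omega> F f" if f: "f \<in> T_inf_v \<omega>" for f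
    proof -
      have "F f = (\<Sum>j. LINT p|\<mu> j. h j p * f p)"
        unfolding F_def using ah[OF T_inf_v_T_inf[OF f]] by simp
      also have "\<dots> = l f"
        using hl[OF f] by (rule sums_unique[symmetric])
      finally show ?thesis
        using T_pairing_eq[OF F(1) T_inf_v_T_inf[OF f]] by simp
    qed
    ultimately show "\<exists>F\<in>T_tilde \<omega>. (\<forall>f\<in>T_inf_v \<omega>. l f = T_pairing \<omega> F f) \<and>
        T_tilde_norm \<omega> F \<le> C * fun_dual_norm (T_inf_v \<omega>) (T_inf_norm \<omega>) l"
      using F unfolding A_def by (intro bexI[of _ F]) auto
  qed
qed

end

theorem theorem4p2:
  fixes g\<^sub>L :: "real \<Rightarrow> real" and \<omega> :: "real \<Rightarrow> real"
  assumes "decay_bound CARD('n::finite) g\<^sub>L"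
    and "orlicz_standing CARD('n) (decay_index CARD('n) g\<^sub>L) \<omega>"
  shows "(\<exists>C>0. \<forall>g \<in> (T_tilde \<omega> :: (((real^'n) \<times> real \<Rightarrow> complex) \<Rightarrow> complex) set).
            (\<lambda>f. T_pairing \<omega> g f) \<in> fun_dual (T_inf_v \<omega>) (T_inf_norm \<omega>) \<and>
            fun_dual_norm (T_inf_v \<omega>) (T_inf_norm \<omega>) (\<lambda>f. T_pairing \<omega> g f)
              \<le> C * T_tilde_norm \<omega> g) \<and>
         (\<exists>C>0. \<forall>l \<in> fun_dual (T_inf_v \<omega> :: ((real^'n) \<times> real \<Rightarrow> complex) set) (T_inf_norm \<omega>).
            \<exists>g \<in> T_tilde \<omega>.
              (\<forall>f \<in> T_inf_v \<omega>. l f = T_pairing \<omega> g f) \<and>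
              T_tilde_norm \<omega> g \<le> C * fun_dual_norm (T_inf_v \<omega>) (T_inf_norm \<omega>) l)"
proof -
  obtain p where "0 < p" "lower_type p \<omega>"
    using orlicz_lower_type_positive[OF assms] .
  then interpret orlicz_function \<omega> p
    using assms(2) by unfold_locales (auto simp: orlicz_standing_def)
  show ?thesis
  proof
    show "\<exists>C>0. \<forall>g \<in> (T_tilde \<omega> :: (((real^'n) \<times> real \<Rightarrow> complex) \<Rightarrow> complex) set).
            (\<lambda>f. T_pairing \<omega> g f) \<in> fun_dual (T_inf_v \<omega>) (T_inf_norm \<omega>) \<and>
            fun_dual_norm (T_inf_v \<omega>) (T_inf_norm \<omega>) (\<lambda>f. T_pairing \<omega> g f)
              \<le> C * T_tilde_norm \<omega> g"
      using T_tilde_subset_dual by (intro exI[of _ 1]) auto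
    obtain C where "0 < C"
      and "\<And>l. l \<in> fun_dual (T_inf_v \<omega> :: ((real^'n) \<times> real \<Rightarrow> complex) set) (T_inf_norm \<omega>) \<Longrightarrow>
      \<exists>F\<in>T_tilde \<omega>. (\<forall>f\<in>T_inf_v \<omega>. l f = T_pairing \<omega> F f) \<and>
        T_tilde_norm \<omega> F \<le> C * fun_dual_norm (T_inf_v \<omega>) (T_inf_norm \<omega>) l"
      using dual_subset_T_tilde by blast
    then show "\<exists>C>0. \<forall>l \<in> fun_dual (T_inf_v \<omega> :: ((real^'n) \<times> real \<Rightarrow> complex) set) (T_inf_norm \<omega>).
            \<exists>g \<in> T_tilde \<omega>.
              (\<forall>f \<in> T_inf_v \<omega>. l f = T_pairing \<omega> g f) \<and>
              T_tilde_norm \<omega> g \<le> C * fun_dual_norm (T_inf_v \<omega>) (T_inf_norm \<omega>) l"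
      by blast
  qed
qed

end
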